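(* Let $L$ be an arbitrary field of characteristic $p>0$. Let $K$ be one of the fields $L((t_1))$, $L((t_1))((t_2))$, $L((t_1))((t_2))((t_3))$, and so on (i.e. $K=L((t_1))\cdots((t_n))$ for some integer $n\ge 1$). Endow $K$ with a valuation onto a group of the form $\mathbb{Z}^k$ with lexicographical order, $k>0$, and with a natural angular component map, and let $\mathcal{L}_{\rm Pas}$ be a language of Denef–Pas for $K$ with this valuation and angular component map. Then $K_0(K,\mathcal{L}_{\rm Pas})=\{0\}$, and there exists an $\mathcal{L}_{\rm Pas}$-definable bijection $K\to K^\times$, where $K^\times=K\setminus\{0\}$.
   Context: Iterated Laurent series fields: $L((t_1))$ is the field of formal Laurent series in $t_1$ over $L$, and inductively $L((t_1))\cdots((t_n))$ is the field of formal Laurent series in $t_n$ over $L((t_1))\cdots((t_{n-1}))$. $\mathcal{L}_{\rm ring}=(+,-,\cdot,0,1)$ is the language of rings. Definable always means definable with parameters; a function is definable if its graph is. Valuations: a valuation on $K$ is a map $v:K\to G\cup\{\infty\}$, $G$ an ordered abelian group, with $v(x)=\infty$ iff $x=0$, $v(xy)=v(x)+v(y)$, $v(x+y)\ge\min\{v(x),v(y)\}$. Write $R=\{x\in K\mid v(x)\ge 0\}$, $M$ for its maximal ideal, and $k_K=R/M$ for the residue field. An angular component map is a group homomorphism $\mathrm{ac}:K^\times\to k_K^\times$, extended by $\mathrm{ac}(0)=0$, with $\mathrm{ac}(x)=x\bmod M$ whenever $v(x)=0$. If the value group is $\mathbb{Z}^k$ and $\tau_1,\dots,\tau_k\in K$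 satisfy $v(\tau_1)=(1,0,\dots,0),\dots,v(\tau_k)=(0,\dots,0,1)$, the natural angular component map (canonical up to the choice of the $\tau_i$) is $\mathrm{ac}(x)=x\prod_i\tau_i^{-r_i}\bmod M$ for $x\neq 0$ with $v(x)=(r_1,\dots,r_k)$. A language of Denef–Pas $\mathcal{L}_{\rm Pas}$ is a three-sorted language $(\mathcal{L}_k,\mathcal{L}_{\rm ring},\mathcal{L}_G,v,\mathrm{ac})$ with a residue field sort (with language $\mathcal{L}_k$, an arbitrary expansion of $\mathcal{L}_{\rm ring}$), a valued field sort $K$ (with language $\mathcal{L}_{\rm ring}$), a value group sort $G\cup\{\infty\}$ (with language $\mathcal{L}_G$, an arbitrary expansion of $(+,-,0,\infty,\le)$), and function symbols $v$ for the valuation $K\to G\cup\{\infty\}$ and $\mathrm{ac}$ for the angular component map from $K$ to the residue field. Grothendieck ring: for $\mathcal{L}$-definable sets $X\subset K^m$, $Y\subset K^n$ ($m,n>0$), write $X\cong_{\mathcal{L}}Y$ if there is an $\mathcal{L}$-definable bijection $X\to Y$. $K_0(K,\mathcal{L})$ is the abelian group generated by symbols $[A]$, for $A$ an $\mathcal{L}$-definable set, with the relations $[A]=[A']$ if $A\cong_{\mathcal{L}}A'$, and $[A]=[B]+[C]$ if $A$ is the disjoint union of the definable sets $B$ and $C$; it is a ring with multiplication induced by $[A\times B]=[A][B]$ (the unit is the class of a point). *)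

theory Defs
  imports "HOL-Algebra.QuotRing" "HOL-Algebra.Free_Abelian_Groups"
begin

section \<open>Iterated Laurent series\<close>

text \<open>
  All the fields of iterated Laurent series over a given field have to live in one HOL type, since
  the number of iterations is a variable. An element of the type below is either a constant from
  the base field or a \<open>\<int>\<close>-indexed family of coefficients from the previous stage.
\<close>

datatype 'a laurent = Const (const: 'a) | Series (coeff: "int \<Rightarrow> 'a laurent")

definition const_ring :: "('a, 'm) ring_scheme \<Rightarrow> 'a laurent ring" where
  "const_ring L =
    \<lparr>carrier = Const ` carrier L,
     monoid.mult = (\<lambda>x y. Const (const x \<otimes>\<^bsub>L\<^esub> const y)),
     one = Const \<one>\<^bsub>L\<^esub>,
     ring.zero = Const \<zero>\<^bsub>L\<^esub>,
     add = (\<lambda>x y. Const (const x \<oplus>\<^bsub>L\<^esub> const y))\<rparr>"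

definition laurent_ring :: "'a laurent ring \<Rightarrow> 'a laurent ring" where
  "laurent_ring R =
    \<lparr>carrier = {Series f | f. range f \<subseteq> carrier R \<and> (\<exists>N. \<forall>i<N. f i = \<zero>\<^bsub>R\<^esub>)},
     monoid.mult = (\<lambda>x y. Series (\<lambda>j.
       \<Oplus>\<^bsub>R\<^esub>i\<in>{i. coeff x i \<noteq> \<zero>\<^bsub>R\<^esub> \<and> coeff y (j - i) \<noteq> \<zero>\<^bsub>R\<^esub>}. coeff x i \<otimes>\<^bsub>R\<^esub> coeff y (j - i))),
     one = Series (\<lambda>i. if i = 0 then \<one>\<^bsub>R\<^esub> else \<zero>\<^bsub>R\<^esub>),
     ring.zero = Series (\<lambda>i. \<zero>\<^bsub>R\<^esub>),
     add = (\<lambda>x y. Series (\<lambda>i. coeff x i \<oplus>\<^bsub>R\<^esub> coeff y i))\<rparr>"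

definition iterated_laurent :: "('a, 'm) ring_scheme \<Rightarrow> nat \<Rightarrow> 'a laurent ring" where
  "iterated_laurent L n = (laurent_ring ^^ n) (const_ring L)"

definition has_characteristic :: "('a, 'm) ring_scheme \<Rightarrow> nat \<Rightarrow> bool" where
  "has_characteristic R p \<longleftrightarrow> (\<forall>n::nat. [n] \<cdot>\<^bsub>R\<^esub> \<one>\<^bsub>R\<^esub> = \<zero>\<^bsub>R\<^esub> \<longleftrightarrow> p dvd n)"


section \<open>Valuations with value group $\mathbb{Z}^k$\<close>

text \<open>
  The group \<open>\<int>\<^sup>k\<close> consists of the integer lists of length \<open>k\<close>, ordered lexicographically;
  \<^term>\<open>None\<close> stands for \<open>\<infinity>\<close>, with the conventions \<open>a + \<infinity> = \<infinity> + a = \<infinity>\<close> and \<open>- \<infinity> = \<infinity>\<close>.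
\<close>

type_synonym zvec = "int list option"

definition zgroup :: "nat \<Rightarrow> zvec set" where
  "zgroup k = {Some r | r. length r = k}"

definition zgroup_inf :: "nat \<Rightarrow> zvec set" where
  "zgroup_inf k = insert None (zgroup k)"

definition zvec_zero :: "nat \<Rightarrow> zvec" where
  "zvec_zero k = Some (replicate k 0)"

definition zvec_unit :: "nat \<Rightarrow> nat \<Rightarrow> zvec" where
  "zvec_unit k i = Some ((replicate k 0)[i := 1])"

fun zvec_add :: "zvec \<Rightarrow> zvec \<Rightarrow> zvec" where
  "zvec_add (Some r) (Some s) = Some (map2 (+) r s)"
| "zvec_add _ _ = None"

definition zvec_uminus :: "zvec \<Rightarrow> zvec" where
  "zvec_uminus = map_option (map uminus)"

fun zvec_le :: "zvec \<Rightarrow> zvec \<Rightarrow> bool" where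
  "zvec_le _ None \<longleftrightarrow> True"
| "zvec_le None (Some _) \<longleftrightarrow> False"
| "zvec_le (Some r) (Some s) \<longleftrightarrow> r = s \<or> (r, s) \<in> lex {(a, b). a < b}"

definition zvec_min :: "zvec \<Rightarrow> zvec \<Rightarrow> zvec" where
  "zvec_min a b = (if zvec_le a b then a else b)"

definition valuation_onto :: "('a, 'm) ring_scheme \<Rightarrow> nat \<Rightarrow> ('a \<Rightarrow> zvec) \<Rightarrow> bool" where
  "valuation_onto K k v \<longleftrightarrow>
     v ` (carrier K - {\<zero>\<^bsub>K\<^esub>}) = zgroup k \<and>
     v \<zero>\<^bsub>K\<^esub> = None \<and>
     (\<forall>x\<in>carrier K. \<forall>y\<in>carrier K. v (x \<otimes>\<^bsub>K\<^esub> y) = zvec_add (v x) (v y)) \<and>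
     (\<forall>x\<in>carrier K. \<forall>y\<in>carrier K. zvec_le (zvec_min (v x) (v y)) (v (x \<oplus>\<^bsub>K\<^esub> y)))"

definition valuation_ring :: "('a, 'm) ring_scheme \<Rightarrow> nat \<Rightarrow> ('a \<Rightarrow> zvec) \<Rightarrow> ('a, 'm) ring_scheme" where
  "valuation_ring K k v = K\<lparr>carrier := {x \<in> carrier K. zvec_le (zvec_zero k) (v x)}\<rparr>"

definition valuation_ideal :: "('a, 'm) ring_scheme \<Rightarrow> nat \<Rightarrow> ('a \<Rightarrow> zvec) \<Rightarrow> 'a set" where
  "valuation_ideal K k v = {x \<in> carrier K. zvec_le (zvec_zero k) (v x) \<and> v x \<noteq> zvec_zero k}"

definition residue_field :: "('a, 'm) ring_scheme \<Rightarrow> nat \<Rightarrow> ('a \<Rightarrow> zvec) \<Rightarrow> 'a set ring" where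
  "residue_field K k v = valuation_ring K k v Quot valuation_ideal K k v"

definition residue_class :: "('a, 'm) ring_scheme \<Rightarrow> nat \<Rightarrow> ('a \<Rightarrow> zvec) \<Rightarrow> 'a \<Rightarrow> 'a set" where
  "residue_class K k v x = valuation_ideal K k v +>\<^bsub>valuation_ring K k v\<^esub> x"

definition natural_ac ::
    "('a, 'm) ring_scheme \<Rightarrow> nat \<Rightarrow> ('a \<Rightarrow> zvec) \<Rightarrow> 'a list \<Rightarrow> 'a \<Rightarrow> 'a set" where
  "natural_ac K k v \<tau> x =
     (if x = \<zero>\<^bsub>K\<^esub> then \<zero>\<^bsub>residue_field K k v\<^esub>
      else residue_class K k v
             (x \<otimes>\<^bsub>K\<^esub> (\<Otimes>\<^bsub>K\<^esub>i\<in>{..<k}. (\<tau> ! i) [^]\<^bsub>K\<^esub> (- (the (v x) ! i)))))"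


section \<open>Denef-Pas languages and their structures\<close>

text \<open>Additional function and relation symbols on one sort, together with their interpretation.\<close>

record ('f, 'r, 'u) expansion =
  funs :: "'f set"
  rels :: "'r set"
  fun_arity :: "'f \<Rightarrow> nat"
  rel_arity :: "'r \<Rightarrow> nat"
  fun_interp :: "'f \<Rightarrow> 'u list \<Rightarrow> 'u"
  rel_interp :: "'r \<Rightarrow> 'u list \<Rightarrow> bool"

definition expansion_on :: "'u set \<Rightarrow> ('f, 'r, 'u) expansion \<Rightarrow> bool" where
  "expansion_on U E \<longleftrightarrow>
     (\<forall>f\<in>funs E. \<forall>us. length us = fun_arity E f \<and> set us \<subseteq> U \<longrightarrow> fun_interp E f us \<in> U)"

record ('a, 'rf, 'rr, 'gf, 'gr) pas_structure =
  valued_field :: "'a ring"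
  residue_sort :: "'a set ring"
  value_rank :: nat
  valuation :: "'a \<Rightarrow> zvec"
  ang_comp :: "'a \<Rightarrow> 'a set"
  residue_exp :: "('rf, 'rr, 'a set) expansion"
  group_exp :: "('gf, 'gr, zvec) expansion"

definition denef_pas_structure ::
    "'a ring \<Rightarrow> nat \<Rightarrow> ('a \<Rightarrow> zvec) \<Rightarrow> 'a list \<Rightarrow>
     ('rf, 'rr, 'a set) expansion \<Rightarrow> ('gf, 'gr, zvec) expansion \<Rightarrow>
     ('a, 'rf, 'rr, 'gf, 'gr) pas_structure" where
  "denef_pas_structure K k v \<tau> E\<^sub>k E\<^sub>G =
    \<lparr>valued_field = K,
     residue_sort = residue_field K k v,
     value_rank = k,
     valuation = v,
     ang_comp = natural_ac K k v \<tau>,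
     residue_exp = E\<^sub>k,
     group_exp = E\<^sub>G\<rparr>"

datatype fterm =
    FVar nat | FZero | FOne
  | FAdd fterm fterm | FUminus fterm | FMult fterm fterm

datatype 'rf rterm =
    RVar nat | RZero | ROne
  | RAdd "'rf rterm" "'rf rterm" | RUminus "'rf rterm" | RMult "'rf rterm" "'rf rterm"
  | RFun 'rf "'rf rterm list"
  | RAc fterm

datatype 'gf gterm =
    GVar nat | GZero | GInf
  | GAdd "'gf gterm" "'gf gterm" | GUminus "'gf gterm"
  | GFun 'gf "'gf gterm list"
  | GVal fterm

datatype ('rf, 'rr, 'gf, 'gr) pas_formula =
    FEq fterm fterm
  | REq "'rf rterm" "'rf rterm"
  | RRel 'rr "'rf rterm list"
  | GEq "'gf gterm" "'gf gterm"
  | GLe "'gf gterm" "'gf gterm"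
  | GRel 'gr "'gf gterm list"
  | Neg "('rf, 'rr, 'gf, 'gr) pas_formula"
  | Conj "('rf, 'rr, 'gf, 'gr) pas_formula" "('rf, 'rr, 'gf, 'gr) pas_formula"
  | FEx nat "('rf, 'rr, 'gf, 'gr) pas_formula"
  | REx nat "('rf, 'rr, 'gf, 'gr) pas_formula"
  | GEx nat "('rf, 'rr, 'gf, 'gr) pas_formula"

fun rterm_wf :: "('rf, 'rr, 'u) expansion \<Rightarrow> 'rf rterm \<Rightarrow> bool" where
  "rterm_wf E (RAdd s t) \<longleftrightarrow> rterm_wf E s \<and> rterm_wf E t"
| "rterm_wf E (RUminus t) \<longleftrightarrow> rterm_wf E t"
| "rterm_wf E (RMult s t) \<longleftrightarrow> rterm_wf E s \<and> rterm_wf E t"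
| "rterm_wf E (RFun f ts) \<longleftrightarrow>
     f \<in> funs E \<and> length ts = fun_arity E f \<and> (\<forall>t\<in>set ts. rterm_wf E t)"
| "rterm_wf E _ \<longleftrightarrow> True"

fun gterm_wf :: "('gf, 'gr, 'u) expansion \<Rightarrow> 'gf gterm \<Rightarrow> bool" where
  "gterm_wf E (GAdd s t) \<longleftrightarrow> gterm_wf E s \<and> gterm_wf E t"
| "gterm_wf E (GUminus t) \<longleftrightarrow> gterm_wf E t"
| "gterm_wf E (GFun f ts) \<longleftrightarrow>
     f \<in> funs E \<and> length ts = fun_arity E f \<and> (\<forall>t\<in>set ts. gterm_wf E t)"
| "gterm_wf E _ \<longleftrightarrow> True"

fun pas_formula_wf ::
    "('a, 'rf, 'rr, 'gf, 'gr) pas_structure \<Rightarrow> ('rf, 'rr, 'gf, 'gr) pas_formula \<Rightarrow> bool" where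
  "pas_formula_wf S (FEq s t) \<longleftrightarrow> True"
| "pas_formula_wf S (REq s t) \<longleftrightarrow>
     rterm_wf (residue_exp S) s \<and> rterm_wf (residue_exp S) t"
| "pas_formula_wf S (RRel r ts) \<longleftrightarrow>
     r \<in> rels (residue_exp S) \<and> length ts = rel_arity (residue_exp S) r \<and>
     (\<forall>t\<in>set ts. rterm_wf (residue_exp S) t)"
| "pas_formula_wf S (GEq s t) \<longleftrightarrow> gterm_wf (group_exp S) s \<and> gterm_wf (group_exp S) t"
| "pas_formula_wf S (GLe s t) \<longleftrightarrow> gterm_wf (group_exp S) s \<and> gterm_wf (group_exp S) t"
| "pas_formula_wf S (GRel r ts) \<longleftrightarrow>
     r \<in> rels (group_exp S) \<and> length ts = rel_arity (group_exp S) r \<and>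
     (\<forall>t\<in>set ts. gterm_wf (group_exp S) t)"
| "pas_formula_wf S (Neg \<phi>) \<longleftrightarrow> pas_formula_wf S \<phi>"
| "pas_formula_wf S (Conj \<phi> \<psi>) \<longleftrightarrow> pas_formula_wf S \<phi> \<and> pas_formula_wf S \<psi>"
| "pas_formula_wf S (FEx i \<phi>) \<longleftrightarrow> pas_formula_wf S \<phi>"
| "pas_formula_wf S (REx i \<phi>) \<longleftrightarrow> pas_formula_wf S \<phi>"
| "pas_formula_wf S (GEx i \<phi>) \<longleftrightarrow> pas_formula_wf S \<phi>"

text \<open>
  The assignments \<open>\<rho>\<close>, \<open>\<sigma>\<close> and \<open>\<gamma>\<close> give values to the variables of the valued field sort, of the
  residue field sort and of the value group sort, respectively.
\<close>

primrec feval :: "'a ring \<Rightarrow> (nat \<Rightarrow> 'a) \<Rightarrow> fterm \<Rightarrow> 'a" where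
  "feval K \<rho> (FVar i) = \<rho> i"
| "feval K \<rho> FZero = \<zero>\<^bsub>K\<^esub>"
| "feval K \<rho> FOne = \<one>\<^bsub>K\<^esub>"
| "feval K \<rho> (FAdd s t) = feval K \<rho> s \<oplus>\<^bsub>K\<^esub> feval K \<rho> t"
| "feval K \<rho> (FUminus t) = \<ominus>\<^bsub>K\<^esub> feval K \<rho> t"
| "feval K \<rho> (FMult s t) = feval K \<rho> s \<otimes>\<^bsub>K\<^esub> feval K \<rho> t"

primrec reval ::
    "('a, 'rf, 'rr, 'gf, 'gr) pas_structure \<Rightarrow> (nat \<Rightarrow> 'a) \<Rightarrow> (nat \<Rightarrow> 'a set) \<Rightarrow> 'rf rterm \<Rightarrow> 'a set" where
  "reval S \<rho> \<sigma> (RVar i) = \<sigma> i"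
| "reval S \<rho> \<sigma> RZero = \<zero>\<^bsub>residue_sort S\<^esub>"
| "reval S \<rho> \<sigma> ROne = \<one>\<^bsub>residue_sort S\<^esub>"
| "reval S \<rho> \<sigma> (RAdd s t) = reval S \<rho> \<sigma> s \<oplus>\<^bsub>residue_sort S\<^esub> reval S \<rho> \<sigma> t"
| "reval S \<rho> \<sigma> (RUminus t) = \<ominus>\<^bsub>residue_sort S\<^esub> reval S \<rho> \<sigma> t"
| "reval S \<rho> \<sigma> (RMult s t) = reval S \<rho> \<sigma> s \<otimes>\<^bsub>residue_sort S\<^esub> reval S \<rho> \<sigma> t"
| "reval S \<rho> \<sigma> (RFun f ts) = fun_interp (residue_exp S) f (map (reval S \<rho> \<sigma>) ts)"
| "reval S \<rho> \<sigma> (RAc t) = ang_comp S (feval (valued_field S) \<rho> t)"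

primrec geval ::
    "('a, 'rf, 'rr, 'gf, 'gr) pas_structure \<Rightarrow> (nat \<Rightarrow> 'a) \<Rightarrow> (nat \<Rightarrow> zvec) \<Rightarrow> 'gf gterm \<Rightarrow> zvec" where
  "geval S \<rho> \<gamma> (GVar i) = \<gamma> i"
| "geval S \<rho> \<gamma> GZero = zvec_zero (value_rank S)"
| "geval S \<rho> \<gamma> GInf = None"
| "geval S \<rho> \<gamma> (GAdd s t) = zvec_add (geval S \<rho> \<gamma> s) (geval S \<rho> \<gamma> t)"
| "geval S \<rho> \<gamma> (GUminus t) = zvec_uminus (geval S \<rho> \<gamma> t)"
| "geval S \<rho> \<gamma> (GFun f ts) = fun_interp (group_exp S) f (map (geval S \<rho> \<gamma>) ts)"
| "geval S \<rho> \<gamma> (GVal t) = valuation S (feval (valued_field S) \<rho> t)"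

primrec pas_sat ::
    "('a, 'rf, 'rr, 'gf, 'gr) pas_structure \<Rightarrow>
     (nat \<Rightarrow> 'a) \<Rightarrow> (nat \<Rightarrow> 'a set) \<Rightarrow> (nat \<Rightarrow> zvec) \<Rightarrow>
     ('rf, 'rr, 'gf, 'gr) pas_formula \<Rightarrow> bool" where
  "pas_sat S \<rho> \<sigma> \<gamma> (FEq s t) \<longleftrightarrow> feval (valued_field S) \<rho> s = feval (valued_field S) \<rho> t"
| "pas_sat S \<rho> \<sigma> \<gamma> (REq s t) \<longleftrightarrow> reval S \<rho> \<sigma> s = reval S \<rho> \<sigma> t"
| "pas_sat S \<rho> \<sigma> \<gamma> (RRel r ts) \<longleftrightarrow> rel_interp (residue_exp S) r (map (reval S \<rho> \<sigma>) ts)"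
| "pas_sat S \<rho> \<sigma> \<gamma> (GEq s t) \<longleftrightarrow> geval S \<rho> \<gamma> s = geval S \<rho> \<gamma> t"
| "pas_sat S \<rho> \<sigma> \<gamma> (GLe s t) \<longleftrightarrow> zvec_le (geval S \<rho> \<gamma> s) (geval S \<rho> \<gamma> t)"
| "pas_sat S \<rho> \<sigma> \<gamma> (GRel r ts) \<longleftrightarrow> rel_interp (group_exp S) r (map (geval S \<rho> \<gamma>) ts)"
| "pas_sat S \<rho> \<sigma> \<gamma> (Neg \<phi>) \<longleftrightarrow> \<not> pas_sat S \<rho> \<sigma> \<gamma> \<phi>"
| "pas_sat S \<rho> \<sigma> \<gamma> (Conj \<phi> \<psi>) \<longleftrightarrow> pas_sat S \<rho> \<sigma> \<gamma> \<phi> \<and> pas_sat S \<rho> \<sigma> \<gamma> \<psi>"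
| "pas_sat S \<rho> \<sigma> \<gamma> (FEx i \<phi>) \<longleftrightarrow>
     (\<exists>x\<in>carrier (valued_field S). pas_sat S (\<rho>(i := x)) \<sigma> \<gamma> \<phi>)"
| "pas_sat S \<rho> \<sigma> \<gamma> (REx i \<phi>) \<longleftrightarrow>
     (\<exists>a\<in>carrier (residue_sort S). pas_sat S \<rho> (\<sigma>(i := a)) \<gamma> \<phi>)"
| "pas_sat S \<rho> \<sigma> \<gamma> (GEx i \<phi>) \<longleftrightarrow>
     (\<exists>r\<in>zgroup_inf (value_rank S). pas_sat S \<rho> \<sigma> (\<gamma>(i := r)) \<phi>)"


section \<open>Definable sets and bijections\<close>

definition cart_power :: "'a set \<Rightarrow> nat \<Rightarrow> 'a list set" where
  "cart_power U m = {xs. length xs = m \<and> set xs \<subseteq> U}"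

text \<open>
  Definability is with parameters from all three sorts: the first \<open>m\<close> variables of the valued
  field sort range over the point, and \<open>\<rho>\<close>, \<open>\<sigma>\<close>, \<open>\<gamma>\<close> provide the parameters.
\<close>

definition definable ::
    "('a, 'rf, 'rr, 'gf, 'gr) pas_structure \<Rightarrow> nat \<Rightarrow> 'a list set \<Rightarrow> bool" where
  "definable S m A \<longleftrightarrow>
     (\<exists>\<phi> \<rho> \<sigma> \<gamma>. pas_formula_wf S \<phi> \<and>
        range \<rho> \<subseteq> carrier (valued_field S) \<and>
        range \<sigma> \<subseteq> carrier (residue_sort S) \<and>
        range \<gamma> \<subseteq> zgroup_inf (value_rank S) \<and>
        A = {xs \<in> cart_power (carrier (valued_field S)) m.
               pas_sat S (\<lambda>i. if i < m then xs ! i else \<rho> i) \<sigma> \<gamma> \<phi>})"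

definition definable_sets :: "('a, 'rf, 'rr, 'gf, 'gr) pas_structure \<Rightarrow> 'a list set set" where
  "definable_sets S = {A. \<exists>m>0. definable S m A}"

definition definable_bij ::
    "('a, 'rf, 'rr, 'gf, 'gr) pas_structure \<Rightarrow> ('a list \<Rightarrow> 'a list) \<Rightarrow>
     nat \<Rightarrow> 'a list set \<Rightarrow> nat \<Rightarrow> 'a list set \<Rightarrow> bool" where
  "definable_bij S f m A n B \<longleftrightarrow>
     definable S m A \<and> definable S n B \<and> bij_betw f A B \<and>
     definable S (m + n) {xs @ f xs | xs. xs \<in> A}"

definition definably_isomorphic ::
    "('a, 'rf, 'rr, 'gf, 'gr) pas_structure \<Rightarrow> 'a list set \<Rightarrow> 'a list set \<Rightarrow> bool" where
  "definably_isomorphic S A B \<longleftrightarrow> (\<exists>f. \<exists>m>0. \<exists>n>0. definable_bij S f m A n B)"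


section \<open>The Grothendieck ring\<close>

definition list_times :: "'a list set \<Rightarrow> 'a list set \<Rightarrow> 'a list set" where
  "list_times A B = {xs @ ys | xs ys. xs \<in> A \<and> ys \<in> B}"

text \<open>
  The free abelian group on the definable sets, with the bilinear product that extends
  \<open>[A][B] = [A \<times> B]\<close>. The class of a point is a unit only modulo the relations below.
\<close>

definition definable_free_ring ::
    "('a, 'rf, 'rr, 'gf, 'gr) pas_structure \<Rightarrow> ('a list set \<Rightarrow>\<^sub>0 int) ring" where
  "definable_free_ring S =
    \<lparr>carrier = carrier (free_Abelian_group (definable_sets S)),
     monoid.mult = (\<lambda>c d. frag_extend (\<lambda>A. frag_extend (\<lambda>B. frag_of (list_times A B)) d) c),
     one = frag_of {[\<zero>\<^bsub>valued_field S\<^esub>]},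
     ring.zero = 0,
     add = (+)\<rparr>"

definition grothendieck_relators ::
    "('a, 'rf, 'rr, 'gf, 'gr) pas_structure \<Rightarrow> ('a list set \<Rightarrow>\<^sub>0 int) set" where
  "grothendieck_relators S =
     {frag_of A - frag_of B | A B. definably_isomorphic S A B} \<union>
     {frag_of A - (frag_of B + frag_of C) | A B C.
        A \<in> definable_sets S \<and> B \<in> definable_sets S \<and> C \<in> definable_sets S \<and>
        A = B \<union> C \<and> B \<inter> C = {}}"

definition grothendieck_ring ::
    "('a, 'rf, 'rr, 'gf, 'gr) pas_structure \<Rightarrow> ('a list set \<Rightarrow>\<^sub>0 int) set ring" where
  "grothendieck_ring S =
     definable_free_ring S Quot
       generate (free_Abelian_group (definable_sets S)) (grothendieck_relators S)"

end

theory Submission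
  imports Defs "HOL-Algebra.Multiplicative_Group" "HOL-Computational_Algebra.Primes"
begin

text \<open>
  Only a few properties of \<open>K\<close> matter. It is a field of prime characteristic \<open>p\<close>. Its valuation ring
  \<open>V\<close> has a maximal ideal \<open>M = t V\<close>, where \<open>t\<close> is the last of the elements \<open>\<tau>\<close>: the last unit vector is
  the least positive element of \<open>\<int>\<^sup>k\<close>. The set \<open>U\<close> of elements with angular component \<open>1\<close> is stable
  under multiplication and division by \<open>t\<close>, and its elements of value zero form \<open>1 + M\<close>.

  The Grothendieck ring is trivial for the following reason. Let \<open>Q = U - M\<close>. Division by \<open>t\<close> maps
  \<open>Q\<close> bijectively onto \<open>U - V\<close>, which is \<open>Q\<close> without \<open>1 + M\<close>, so that \<open>[M] = [1 + M] = 0\<close>. Since \<open>V\<close>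
  and \<open>M\<close> are in bijection, \<open>B = M - {0}\<close> and \<open>B' = V - {0}\<close> both have the class \<open>-1\<close>. Now \<open>B \<times> B\<close> is
  the union of the set of pairs \<open>(x, y)\<close> with \<open>y / x \<in> V\<close>, which is in bijection with \<open>B \<times> B'\<close> by
  \<open>(x, y) \<mapsto> (x, y / x)\<close>, and of the set of the remaining pairs, which is in bijection with \<open>B \<times> B\<close> by
  \<open>(x, y) \<mapsto> (x / y, y)\<close>. Hence \<open>1 = [B] [B'] = 0\<close>.

  Written out as bijections, this computation gives a subset \<open>Z\<close> of the plane without the origin, and
  an explicit definable bijection \<open>shift\<close> from \<open>Z \<union> {(0, 0)}\<close> onto \<open>Z\<close> (lemma \<open>bij_shift\<close>). Here the
  characteristic comes in: as the Frobenius map is additive and \<open>t\<close> is not a quotient of \<open>p\<close>-th powers,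
  \<open>(x, y) \<mapsto> x\<^sup>p + t y\<^sup>p\<close> embeds the plane into the line (lemma \<open>inj_embed\<close>). Transporting \<open>shift\<close> along
  this embedding and extending it by the identity gives the bijection from \<open>K\<close> to \<open>K - {0}\<close> (lemma
  \<open>bij_puncture\<close>).

  In turn, such a bijection kills the class of every definable set \<open>A\<close>: multiplied with \<open>A\<close> it
  shows that \<open>[A \<times> K] = [A \<times> (K - {0})]\<close>, and therefore \<open>[A] = [A \<times> {0}] = 0\<close> (theorem
  \<open>grothendieck_ring_trivial\<close>). The definability of the sets and graphs involved rests on closure of the
  definable sets under intersection, complement and selection of coordinates, for which the
  variables of formulas have to be renamed.
\<close>

section \<open>The field of Laurent series over a field\<close>

lemma (in abelian_monoid) finsum_swap:
  assumes "finite A" "finite B" "\<And>a b. a \<in> A \<Longrightarrow> b \<in> B \<Longrightarrow> f a b \<in> carrier G"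
  shows "(\<Oplus>a\<in>A. \<Oplus>b\<in>B. f a b) = (\<Oplus>b\<in>B. \<Oplus>a\<in>A. f a b)"
  using assms(1,3)
proof (induction A rule: finite_induct)
  case empty
  then show ?case by simp
next
  case (insert x A)
  have "(\<Oplus>a\<in>insert x A. \<Oplus>b\<in>B. f a b) = (\<Oplus>b\<in>B. f x b) \<oplus> (\<Oplus>b\<in>B. \<Oplus>a\<in>A. f a b)"
    using insert by (subst finsum_insert) (auto intro!: finsum_closed)
  also have "\<dots> = (\<Oplus>b\<in>B. f x b \<oplus> (\<Oplus>a\<in>A. f a b))"
    using insert by (intro finsum_addf[symmetric]) (auto intro!: finsum_closed)
  also have "\<dots> = (\<Oplus>b\<in>B. \<Oplus>a\<in>insert x A. f a b)"
    using insert by (intro finsum_cong') (auto intro!: finsum_closed)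
  finally show ?case .
qed

text \<open>The coefficient of degree \<open>j\<close> of the product of the Laurent series with coefficients \<open>f\<close> and \<open>g\<close>.
  The sum extends over the nonzero terms, which are finitely many if \<open>f\<close> and \<open>g\<close> vanish in all
  sufficiently small degrees.\<close>

definition convolution :: "('a, 'm) ring_scheme \<Rightarrow> (int \<Rightarrow> 'a) \<Rightarrow> (int \<Rightarrow> 'a) \<Rightarrow> int \<Rightarrow> 'a" where
  "convolution R f g j =
     (\<Oplus>\<^bsub>R\<^esub>i\<in>{i. f i \<noteq> \<zero>\<^bsub>R\<^esub> \<and> g (j - i) \<noteq> \<zero>\<^bsub>R\<^esub>}. f i \<otimes>\<^bsub>R\<^esub> g (j - i))"

text \<open>The families that are the coefficients of a Laurent series.\<close>

definition laurent_coeffs :: "('a, 'm) ring_scheme \<Rightarrow> (int \<Rightarrow> 'a) set" where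
  "laurent_coeffs R = {f. range f \<subseteq> carrier R \<and> (\<exists>N. \<forall>i<N. f i = \<zero>\<^bsub>R\<^esub>)}"

context cring
begin

lemma laurent_coeffs_closed: "f \<in> laurent_coeffs R \<Longrightarrow> f i \<in> carrier R"
  by (auto simp: laurent_coeffs_def)

lemma laurent_coeffs_bound:
  assumes "f \<in> laurent_coeffs R"
  obtains N where "\<And>i. f i \<noteq> \<zero> \<Longrightarrow> N \<le> i"
  using assms by (force simp: laurent_coeffs_def not_less[symmetric])

lemma convolution_eq:
  assumes "range f \<subseteq> carrier R" "range g \<subseteq> carrier R" "finite I"
    and "\<And>i. f i \<noteq> \<zero> \<Longrightarrow> g (j - i) \<noteq> \<zero> \<Longrightarrow> i \<in> I"
  shows "convolution R f g j = (\<Oplus>i\<in>I. f i \<otimes> g (j - i))"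
  unfolding convolution_def
proof (rule add.finprod_mono_neutral_cong_left)
  fix i assume "i \<in> I - {i. f i \<noteq> \<zero> \<and> g (j - i) \<noteq> \<zero>}"
  moreover have "f i \<in> carrier R" "g (j - i) \<in> carrier R"
    using assms by auto
  ultimately show "f i \<otimes> g (j - i) = \<zero>"
    by auto
qed (use assms in \<open>auto simp: image_subset_iff\<close>)

lemma convolution_in_carrier:
  assumes "range f \<subseteq> carrier R" "range g \<subseteq> carrier R"
  shows "convolution R f g j \<in> carrier R"
  unfolding convolution_def using assms by (intro finsum_closed) (auto simp: image_subset_iff)

lemma convolution_eq_interval:
  assumes "f \<in> laurent_coeffs R" "g \<in> laurent_coeffs R"
    and "\<And>i. f i \<noteq> \<zero> \<Longrightarrow> M \<le> i" "\<And>i. g i \<noteq> \<zero> \<Longrightarrow> N \<le> i" "m \<le> M" "j - N \<le> n"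
  shows "convolution R f g j = (\<Oplus>i\<in>{m..n}. f i \<otimes> g (j - i))"
proof (rule convolution_eq)
  fix i assume "f i \<noteq> \<zero>" "g (j - i) \<noteq> \<zero>"
  then have "M \<le> i" "N \<le> j - i"
    using assms(3,4) by blast+
  then show "i \<in> {m..n}"
    using assms(5,6) by auto
qed (use assms in \<open>auto simp: laurent_coeffs_def\<close>)

lemma convolution_bound:
  assumes "f \<in> laurent_coeffs R" "g \<in> laurent_coeffs R"
    and "\<And>i. f i \<noteq> \<zero> \<Longrightarrow> M \<le> i" "\<And>i. g i \<noteq> \<zero> \<Longrightarrow> N \<le> i"
    and "convolution R f g j \<noteq> \<zero>"
  shows "M + N \<le> j"
proof (rule ccontr)
  assume "\<not> M + N \<le> j"
  then have "{M..j - N} = {}"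
    by auto
  then have "convolution R f g j = \<zero>"
    using convolution_eq_interval[OF assms(1-4) order.refl order.refl, of j] by simp
  with assms(5) show False by simp
qed

lemma convolution_closed:
  assumes "f \<in> laurent_coeffs R" "g \<in> laurent_coeffs R"
  shows "convolution R f g \<in> laurent_coeffs R"
proof -
  obtain M where M: "\<And>i. f i \<noteq> \<zero> \<Longrightarrow> M \<le> i"
    using laurent_coeffs_bound[OF assms(1)] by blast
  obtain N where N: "\<And>i. g i \<noteq> \<zero> \<Longrightarrow> N \<le> i"
    using laurent_coeffs_bound[OF assms(2)] by blast
  have "\<forall>j<M + N. convolution R f g j = \<zero>"
    using convolution_bound[OF assms M N] by force
  then show ?thesis
    using assms by (auto simp: laurent_coeffs_def intro!: convolution_in_carrier)
qed

lemma convolution_comm: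
  assumes "f \<in> laurent_coeffs R" "g \<in> laurent_coeffs R"
  shows "convolution R f g = convolution R g f"
proof
  fix j
  have f: "range f \<subseteq> carrier R" and g: "range g \<subseteq> carrier R"
    using assms by (auto simp: laurent_coeffs_def)
  let ?A = "{i. f i \<noteq> \<zero> \<and> g (j - i) \<noteq> \<zero>}"
  let ?B = "{i. g i \<noteq> \<zero> \<and> f (j - i) \<noteq> \<zero>}"
  have B: "?B = (\<lambda>i. j - i) ` ?A"
    by (auto simp: image_iff intro!: exI[of _ "j - _"])
  have "convolution R g f j = (\<Oplus>i\<in>(\<lambda>i. j - i) ` ?A. g i \<otimes> f (j - i))"
    unfolding convolution_def B ..
  also have "\<dots> = (\<Oplus>i\<in>?A. g (j - i) \<otimes> f (j - (j - i)))"
    using f g by (intro add.finprod_reindex) (auto simp: inj_on_def image_subset_iff)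
  also have "\<dots> = convolution R f g j"
    unfolding convolution_def using f g
    by (intro finsum_cong') (auto simp: image_subset_iff m_comm)
  finally show "convolution R f g j = convolution R g f j" ..
qed

text \<open>With lower bounds \<open>M\<close>, \<open>N\<close>, \<open>P\<close> of the degrees in \<open>f\<close>, \<open>g\<close>, \<open>h\<close>, both sides are the sum of
  \<open>f a \<otimes> g (i - a) \<otimes> h (j - i)\<close> over the same finite rectangle of pairs \<open>(a, i)\<close>.\<close>

lemma convolution_assoc:
  assumes "f \<in> laurent_coeffs R" "g \<in> laurent_coeffs R" "h \<in> laurent_coeffs R"
  shows "convolution R (convolution R f g) h = convolution R f (convolution R g h)"
proof
  fix j
  obtain M where M: "\<And>i. f i \<noteq> \<zero> \<Longrightarrow> M \<le> i"
    using laurent_coeffs_bound[OF assms(1)] by blast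
  obtain N where N: "\<And>i. g i \<noteq> \<zero> \<Longrightarrow> N \<le> i"
    using laurent_coeffs_bound[OF assms(2)] by blast
  obtain P where P: "\<And>i. h i \<noteq> \<zero> \<Longrightarrow> P \<le> i"
    using laurent_coeffs_bound[OF assms(3)] by blast
  have f: "\<And>i. f i \<in> carrier R" and g: "\<And>i. g i \<in> carrier R" and h: "\<And>i. h i \<in> carrier R"
    using assms by (auto intro: laurent_coeffs_closed)
  let ?I = "{M + N..j - P}" and ?A = "{M..j - P - N}"
  note fg = convolution_closed[OF assms(1,2)] and gh = convolution_closed[OF assms(2,3)]
  have gh_eq: "convolution R g h (j - a) = (\<Oplus>i\<in>?I. g (i - a) \<otimes> h (j - i))" if "a \<in> ?A" for a
  proof -
    have "convolution R g h (j - a) = (\<Oplus>i\<in>{M + N - a..j - P - a}. g i \<otimes> h (j - a - i))"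
      by (rule convolution_eq_interval[OF assms(2,3) N P]) (use that in auto)
    also have "{M + N - a..j - P - a} = (\<lambda>i. i - a) ` ?I"
      using image_add_atLeastAtMost[of "- a" "M + N" "j - P"] by simp
    also have "(\<Oplus>i\<in>(\<lambda>i. i - a) ` ?I. g i \<otimes> h (j - a - i)) =
        (\<Oplus>i\<in>?I. g (i - a) \<otimes> h (j - a - (i - a)))"
      by (intro add.finprod_reindex) (auto simp: g h inj_on_def)
    finally show ?thesis by simp
  qed
  have "convolution R (convolution R f g) h j = (\<Oplus>i\<in>?I. convolution R f g i \<otimes> h (j - i))"
    by (rule convolution_eq_interval[OF fg assms(3) convolution_bound[OF assms(1,2) M N] P]) auto
  also have "\<dots> = (\<Oplus>i\<in>?I. (\<Oplus>a\<in>?A. f a \<otimes> g (i - a)) \<otimes> h (j - i))"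
  proof (intro finsum_cong' refl)
    fix i assume "i \<in> ?I"
    then have "convolution R f g i = (\<Oplus>a\<in>?A. f a \<otimes> g (i - a))"
      by (intro convolution_eq_interval[OF assms(1,2) M N]) auto
    then show "convolution R f g i \<otimes> h (j - i) = (\<Oplus>a\<in>?A. f a \<otimes> g (i - a)) \<otimes> h (j - i)"
      by simp
  qed (auto intro!: finsum_closed simp: f g h)
  also have "\<dots> = (\<Oplus>i\<in>?I. \<Oplus>a\<in>?A. f a \<otimes> (g (i - a) \<otimes> h (j - i)))"
    by (intro finsum_cong' refl) (auto simp: finsum_ldistr f g h m_assoc intro!: finsum_closed)
  also have "\<dots> = (\<Oplus>a\<in>?A. \<Oplus>i\<in>?I. f a \<otimes> (g (i - a) \<otimes> h (j - i)))"
    by (rule finsum_swap) (auto simp: f g h)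
  also have "\<dots> = (\<Oplus>a\<in>?A. f a \<otimes> convolution R g h (j - a))"
    by (intro finsum_cong' refl)
      (auto simp: gh_eq finsum_rdistr f g h laurent_coeffs_closed[OF gh] intro!: finsum_closed)
  also have "\<dots> = convolution R f (convolution R g h) j"
    by (rule convolution_eq_interval[OF assms(1) gh M convolution_bound[OF assms(2,3) N P], symmetric])
      auto
  finally show "convolution R (convolution R f g) h j = convolution R f (convolution R g h) j" .
qed

lemma laurent_coeffs_add:
  assumes "f \<in> laurent_coeffs R" "g \<in> laurent_coeffs R"
  shows "(\<lambda>i. f i \<oplus> g i) \<in> laurent_coeffs R"
proof -
  obtain M N where "\<And>i. f i \<noteq> \<zero> \<Longrightarrow> M \<le> i" "\<And>i. g i \<noteq> \<zero> \<Longrightarrow> N \<le> i"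
    using laurent_coeffs_bound assms by metis
  then have "f i \<oplus> g i = \<zero>" if "i < min M N" for i
    using that by (metis linorder_not_less min_less_iff_conj l_zero zero_closed)
  moreover have "f i \<oplus> g i \<in> carrier R" for i
    using assms by (simp add: laurent_coeffs_closed)
  ultimately show ?thesis
    unfolding laurent_coeffs_def by blast
qed

lemma laurent_coeffs_uminus: "f \<in> laurent_coeffs R \<Longrightarrow> (\<lambda>i. \<ominus> f i) \<in> laurent_coeffs R"
  by (fastforce simp: laurent_coeffs_def)

lemma convolution_add:
  assumes "f \<in> laurent_coeffs R" "g \<in> laurent_coeffs R" "h \<in> laurent_coeffs R"
  shows "convolution R (\<lambda>i. f i \<oplus> g i) h = (\<lambda>j. convolution R f h j \<oplus> convolution R g h j)"
proof
  fix j
  obtain M where M: "\<And>i. f i \<noteq> \<zero> \<Longrightarrow> M \<le> i"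
    using laurent_coeffs_bound[OF assms(1)] by blast
  obtain N where N: "\<And>i. g i \<noteq> \<zero> \<Longrightarrow> N \<le> i"
    using laurent_coeffs_bound[OF assms(2)] by blast
  obtain P where P: "\<And>i. h i \<noteq> \<zero> \<Longrightarrow> P \<le> i"
    using laurent_coeffs_bound[OF assms(3)] by blast
  have f: "\<And>i. f i \<in> carrier R" and g: "\<And>i. g i \<in> carrier R" and h: "\<And>i. h i \<in> carrier R"
    using assms by (auto intro: laurent_coeffs_closed)
  have MN: "min M N \<le> i" if "f i \<oplus> g i \<noteq> \<zero>" for i
    using that M[of i] N[of i] g[of i] by (cases "f i = \<zero>") auto
  let ?I = "{min M N..j - P}"
  have "convolution R (\<lambda>i. f i \<oplus> g i) h j = (\<Oplus>i\<in>?I. (f i \<oplus> g i) \<otimes> h (j - i))"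
    by (rule convolution_eq_interval[OF laurent_coeffs_add[OF assms(1,2)] assms(3) MN P]) auto
  also have "\<dots> = (\<Oplus>i\<in>?I. f i \<otimes> h (j - i)) \<oplus> (\<Oplus>i\<in>?I. g i \<otimes> h (j - i))"
    using f g h by (simp add: l_distr finsum_addf)
  also have "(\<Oplus>i\<in>?I. f i \<otimes> h (j - i)) = convolution R f h j"
    by (rule convolution_eq_interval[OF assms(1,3) M P, symmetric]) auto
  also have "(\<Oplus>i\<in>?I. g i \<otimes> h (j - i)) = convolution R g h j"
    by (rule convolution_eq_interval[OF assms(2,3) N P, symmetric]) auto
  finally show "convolution R (\<lambda>i. f i \<oplus> g i) h j = convolution R f h j \<oplus> convolution R g h j" .
qed

lemma convolution_one:
  assumes "f \<in> laurent_coeffs R"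
  shows "convolution R (\<lambda>i. if i = 0 then \<one> else \<zero>) f = f"
proof
  fix j
  have f: "\<And>i. f i \<in> carrier R"
    using assms by (auto intro: laurent_coeffs_closed)
  have "convolution R (\<lambda>i. if i = 0 then \<one> else \<zero>) f j =
      (\<Oplus>i\<in>{0}. (if i = 0 then \<one> else \<zero>) \<otimes> f (j - i))"
    by (rule convolution_eq) (use f in \<open>auto split: if_splits\<close>)
  also have "\<dots> = f j"
    using f by simp
  finally show "convolution R (\<lambda>i. if i = 0 then \<one> else \<zero>) f j = f j" .
qed

end

text \<open>The coefficients of the inverse of a series with lowest term in degree \<open>N\<close> are found
  recursively: the coefficient \<open>c n\<close> of degree \<open>n - N\<close> is determined by those of lower degree.\<close>

lemma (in field) convolution_inverse:
  assumes f: "f \<in> laurent_coeffs R" and "f \<noteq> (\<lambda>i. \<zero>)"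
  shows "\<exists>g\<in>laurent_coeffs R. convolution R f g = (\<lambda>i. if i = 0 then \<one> else \<zero>)"
proof -
  have fc [simp]: "f i \<in> carrier R" for i
    using f by (rule laurent_coeffs_closed)
  obtain M where M: "\<And>i. f i \<noteq> \<zero> \<Longrightarrow> M \<le> i"
    using laurent_coeffs_bound[OF f] by blast
  obtain i0 where i0: "f i0 \<noteq> \<zero>"
    using assms(2) by auto
  define m where "m = (LEAST m. f (M + int m) \<noteq> \<zero>)"
  define N where "N = M + int m"
  have "f (M + int (nat (i0 - M))) \<noteq> \<zero>"
    using i0 M[OF i0] by simp
  then have "f (M + int m) \<noteq> \<zero>"
    unfolding m_def by (rule LeastI)
  then have fN: "f N \<noteq> \<zero>" by (simp add: N_def)
  have N: "N \<le> i" if "f i \<noteq> \<zero>" for i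
  proof -
    have "f (M + int (nat (i - M))) \<noteq> \<zero>"
      using that M[OF that] by simp
    then have "m \<le> nat (i - M)"
      unfolding m_def by (rule Least_le)
    then show ?thesis
      using M[OF that] by (simp add: N_def)
  qed
  \<comment> \<open>Well-founded choice needs a condition that is solvable for every \<open>c\<close>, so the equation is
    only required when the previous values lie in the carrier.\<close>
  have "\<exists>c. \<forall>n::nat. c n \<in> carrier R \<and> ((\<forall>i<n. c i \<in> carrier R) \<longrightarrow>
      f N \<otimes> c n \<oplus> (\<Oplus>i\<in>{..<n}. c i \<otimes> f (N + int (n - i))) = (if n = 0 then \<one> else \<zero>))"
  proof (rule dependent_wf_choice[OF wf_less_than, where P = "\<lambda>c n r. r \<in> carrier R \<and>
      ((\<forall>i<n. c i \<in> carrier R) \<longrightarrow>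
      f N \<otimes> r \<oplus> (\<Oplus>i\<in>{..<n}. c i \<otimes> f (N + int (n - i))) = (if n = 0 then \<one> else \<zero>))"])
    fix c d :: "nat \<Rightarrow> 'a" and n r
    assume eq: "\<And>z. (z, n) \<in> less_than \<Longrightarrow> c z = d z"
    have cd: "(\<forall>i<n. c i \<in> carrier R) \<longleftrightarrow> (\<forall>i<n. d i \<in> carrier R)"
      using eq by simp
    have "(\<Oplus>i\<in>{..<n}. c i \<otimes> f (N + int (n - i))) = (\<Oplus>i\<in>{..<n}. d i \<otimes> f (N + int (n - i)))"
      if "\<forall>i<n. d i \<in> carrier R"
      using eq that by (intro finsum_cong') auto
    with cd show "(r \<in> carrier R \<and> ((\<forall>i<n. c i \<in> carrier R) \<longrightarrow>
        f N \<otimes> r \<oplus> (\<Oplus>i\<in>{..<n}. c i \<otimes> f (N + int (n - i))) = (if n = 0 then \<one> else \<zero>))) =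
      (r \<in> carrier R \<and> ((\<forall>i<n. d i \<in> carrier R) \<longrightarrow>
        f N \<otimes> r \<oplus> (\<Oplus>i\<in>{..<n}. d i \<otimes> f (N + int (n - i))) = (if n = 0 then \<one> else \<zero>)))"
      by (simp cong: conj_cong imp_cong)
  next
    fix n :: nat and c :: "nat \<Rightarrow> 'a"
    let ?s = "\<Oplus>i\<in>{..<n}. c i \<otimes> f (N + int (n - i))" and ?d = "if n = 0 then \<one> else \<zero>"
    show "\<exists>r. r \<in> carrier R \<and> ((\<forall>i<n. c i \<in> carrier R) \<longrightarrow> f N \<otimes> r \<oplus> ?s = ?d)"
    proof (cases "\<forall>i<n. c i \<in> carrier R")
      case True
      then have s: "?s \<in> carrier R"
        by (intro finsum_closed) auto
      have u: "inv (f N) \<in> carrier R" "f N \<otimes> inv (f N) = \<one>"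
        using fN by (auto simp: field_Units)
      have d: "?d \<in> carrier R" by simp
      have "f N \<otimes> (inv (f N) \<otimes> (?d \<ominus> ?s)) = ?d \<ominus> ?s"
        using u s d by (simp flip: m_assoc)
      then have "f N \<otimes> (inv (f N) \<otimes> (?d \<ominus> ?s)) \<oplus> ?s = ?d"
        using s d by (simp add: a_minus_def a_assoc l_neg del: r_distr)
      moreover have "inv (f N) \<otimes> (?d \<ominus> ?s) \<in> carrier R"
        using u s d by simp
      ultimately show ?thesis by blast
    next
      case False
      then show ?thesis by blast
    qed
  qed
  then obtain c where cc: "\<And>n. c n \<in> carrier R" and c: "\<And>n::nat.
      f N \<otimes> c n \<oplus> (\<Oplus>i\<in>{..<n}. c i \<otimes> f (N + int (n - i))) = (if n = 0 then \<one> else \<zero>)"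
    by metis
  define g where "g i = (if i < - N then \<zero> else c (nat (i + N)))" for i
  have gN: "- N \<le> i" if "g i \<noteq> \<zero>" for i
    using that by (auto simp: g_def split: if_splits)
  have g: "g \<in> laurent_coeffs R"
    by (auto simp: laurent_coeffs_def g_def cc intro!: exI[of _ "- N"])
  have "convolution R f g j = (if j = 0 then \<one> else \<zero>)" for j
  proof (cases "j < 0")
    case True
    then show ?thesis
      using convolution_bound[OF f g N gN, of j] by force
  next
    case False
    define n where "n = nat j"
    have j: "j = int n" using False by (simp add: n_def)
    have "convolution R f g j = convolution R g f j"
      using convolution_comm[OF f g] by simp
    also have "\<dots> = (\<Oplus>i\<in>{- N..j - N}. g i \<otimes> f (j - i))"
      by (rule convolution_eq_interval[OF g f gN N]) auto
    also have "{- N..j - N} = (\<lambda>i. int i - N) ` {..n}"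
    proof (intro equalityI subsetI)
      fix i assume "i \<in> {- N..j - N}"
      then show "i \<in> (\<lambda>i. int i - N) ` {..n}"
        by (intro image_eqI[of _ _ "nat (i + N)"]) (auto simp: j)
    qed (auto simp: j)
    also have "(\<Oplus>i\<in>(\<lambda>i. int i - N) ` {..n}. g i \<otimes> f (j - i)) =
        (\<Oplus>i\<in>{..n}. g (int i - N) \<otimes> f (j - (int i - N)))"
      by (intro add.finprod_reindex) (auto simp: inj_on_def laurent_coeffs_closed[OF g])
    also have "\<dots> = (\<Oplus>i\<in>{..n}. c i \<otimes> f (N + int (n - i)))"
      by (intro finsum_cong') (auto simp: g_def cc j of_nat_diff algebra_simps)
    also have "{..n} = insert n {..<n}" by auto
    also have "(\<Oplus>i\<in>insert n {..<n}. c i \<otimes> f (N + int (n - i))) =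
        f N \<otimes> c n \<oplus> (\<Oplus>i\<in>{..<n}. c i \<otimes> f (N + int (n - i)))"
      by (subst finsum_insert) (auto simp: cc m_comm)
    also have "\<dots> = (if j = 0 then \<one> else \<zero>)"
      using c[of n] by (simp add: j)
    finally show ?thesis .
  qed
  with g show ?thesis by blast
qed

lemma laurent_ring_simps:
  "carrier (laurent_ring R) = Series ` laurent_coeffs R"
  "x \<otimes>\<^bsub>laurent_ring R\<^esub> y = Series (convolution R (laurent.coeff x) (laurent.coeff y))"
  "\<one>\<^bsub>laurent_ring R\<^esub> = Series (\<lambda>i. if i = 0 then \<one>\<^bsub>R\<^esub> else \<zero>\<^bsub>R\<^esub>)"
  "\<zero>\<^bsub>laurent_ring R\<^esub> = Series (\<lambda>i. \<zero>\<^bsub>R\<^esub>)"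
  "x \<oplus>\<^bsub>laurent_ring R\<^esub> y = Series (\<lambda>i. laurent.coeff x i \<oplus>\<^bsub>R\<^esub> laurent.coeff y i)"
  by (auto simp: laurent_ring_def laurent_coeffs_def convolution_def)

theorem field_laurent_ring:
  assumes "field R"
  shows "field (laurent_ring R)"
proof -
  interpret field R by fact
  have one: "(\<lambda>i. if i = 0 then \<one>\<^bsub>R\<^esub> else \<zero>\<^bsub>R\<^esub>) \<in> laurent_coeffs R"
    and zero: "(\<lambda>i. \<zero>\<^bsub>R\<^esub>) \<in> laurent_coeffs R"
    by (auto simp: laurent_coeffs_def intro!: exI[of _ 0])
  have "abelian_group (laurent_ring R)"
  proof (rule abelian_groupI)
    fix x assume "x \<in> carrier (laurent_ring R)"
    then obtain f where f: "x = Series f" "f \<in> laurent_coeffs R"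
      by (auto simp: laurent_ring_simps)
    show "\<exists>y\<in>carrier (laurent_ring R). y \<oplus>\<^bsub>laurent_ring R\<^esub> x = \<zero>\<^bsub>laurent_ring R\<^esub>"
      using laurent_coeffs_uminus[OF f(2)] laurent_coeffs_closed[OF f(2)]
      by (auto simp: laurent_ring_simps f(1) l_neg intro!: bexI[of _ "\<lambda>i. \<ominus>\<^bsub>R\<^esub> f i"])
  qed (auto simp: laurent_ring_simps laurent_coeffs_add laurent_coeffs_closed zero a_ac)
  moreover have "comm_monoid (laurent_ring R)"
  proof (rule comm_monoidI)
    fix x y assume "x \<in> carrier (laurent_ring R)" "y \<in> carrier (laurent_ring R)"
    then show "x \<otimes>\<^bsub>laurent_ring R\<^esub> y = y \<otimes>\<^bsub>laurent_ring R\<^esub> x"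
      using convolution_comm by (auto simp: laurent_ring_simps)
  qed (auto simp: laurent_ring_simps convolution_closed one convolution_assoc convolution_one)
  ultimately interpret L: cring "laurent_ring R"
    by (rule cringI) (auto simp: laurent_ring_simps convolution_add)
  show ?thesis
  proof (rule L.cring_fieldI2)
    show "\<zero>\<^bsub>laurent_ring R\<^esub> \<noteq> \<one>\<^bsub>laurent_ring R\<^esub>"
      by (auto simp: laurent_ring_simps fun_eq_iff)
  next
    fix x assume "x \<in> carrier (laurent_ring R)" "x \<noteq> \<zero>\<^bsub>laurent_ring R\<^esub>"
    then obtain f where f: "x = Series f" "f \<in> laurent_coeffs R" "f \<noteq> (\<lambda>i. \<zero>\<^bsub>R\<^esub>)"
      by (auto simp: laurent_ring_simps)
    then show "\<exists>y\<in>carrier (laurent_ring R). x \<otimes>\<^bsub>laurent_ring R\<^esub> y = \<one>\<^bsub>laurent_ring R\<^esub>"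
      using convolution_inverse[of f] by (auto simp: laurent_ring_simps)
  qed
qed

lemma field_const_ring:
  assumes "field L"
  shows "field (const_ring L)"
proof -
  interpret field L by fact
  have "abelian_group (const_ring L)"
  proof (rule abelian_groupI)
    fix x assume "x \<in> carrier (const_ring L)"
    then obtain a where "a \<in> carrier L" "x = Const a"
      by (auto simp: const_ring_def)
    then show "\<exists>y\<in>carrier (const_ring L). y \<oplus>\<^bsub>const_ring L\<^esub> x = \<zero>\<^bsub>const_ring L\<^esub>"
      by (auto simp: const_ring_def l_neg intro!: bexI[of _ "\<ominus>\<^bsub>L\<^esub> a"])
  qed (auto simp: const_ring_def a_ac)
  moreover have "comm_monoid (const_ring L)"
    by (rule comm_monoidI) (auto simp: const_ring_def m_ac)
  ultimately interpret C: cring "const_ring L"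
    by (rule cringI) (auto simp: const_ring_def l_distr)
  show ?thesis
  proof (rule C.cring_fieldI2)
    fix x assume "x \<in> carrier (const_ring L)" "x \<noteq> \<zero>\<^bsub>const_ring L\<^esub>"
    then obtain a where "a \<in> carrier L" "x = Const a" "a \<noteq> \<zero>\<^bsub>L\<^esub>"
      by (auto simp: const_ring_def)
    then show "\<exists>y\<in>carrier (const_ring L). x \<otimes>\<^bsub>const_ring L\<^esub> y = \<one>\<^bsub>const_ring L\<^esub>"
      by (auto simp: const_ring_def field_Units intro!: bexI[of _ "inv\<^bsub>L\<^esub> a"])
  qed (auto simp: const_ring_def)
qed

lemma add_pow_one_const_ring:
  fixes n :: nat
  shows "[n] \<cdot>\<^bsub>const_ring L\<^esub> \<one>\<^bsub>const_ring L\<^esub> = Const ([n] \<cdot>\<^bsub>L\<^esub> \<one>\<^bsub>L\<^esub>)"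
  by (induction n) (auto simp: add_pow_def const_ring_def nat_pow_def)

lemma add_pow_one_laurent_ring:
  fixes n :: nat
  assumes "field R"
  shows "[n] \<cdot>\<^bsub>laurent_ring R\<^esub> \<one>\<^bsub>laurent_ring R\<^esub> =
    Series (\<lambda>i. if i = 0 then [n] \<cdot>\<^bsub>R\<^esub> \<one>\<^bsub>R\<^esub> else \<zero>\<^bsub>R\<^esub>)"
proof -
  interpret field R by fact
  show ?thesis
    by (induction n) (auto simp: add_pow_def laurent_ring_simps nat_pow_def fun_eq_iff)
qed

lemma iterated_laurent_field:
  assumes "field L" "has_characteristic L p"
  shows "field (iterated_laurent L n)" "has_characteristic (iterated_laurent L n) p"
proof -
  have "field (iterated_laurent L n) \<and> has_characteristic (iterated_laurent L n) p"
  proof (induction n)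
    case 0
    have "has_characteristic (const_ring L) p"
      using assms(2) unfolding has_characteristic_def add_pow_one_const_ring
      by (simp add: const_ring_def)
    with assms(1) show ?case
      by (simp add: iterated_laurent_def field_const_ring)
  next
    case (Suc n)
    let ?K = "iterated_laurent L n"
    have "has_characteristic (laurent_ring ?K) p"
      unfolding has_characteristic_def
    proof
      fix m :: nat
      have "[m] \<cdot>\<^bsub>laurent_ring ?K\<^esub> \<one>\<^bsub>laurent_ring ?K\<^esub> = \<zero>\<^bsub>laurent_ring ?K\<^esub> \<longleftrightarrow>
          [m] \<cdot>\<^bsub>?K\<^esub> \<one>\<^bsub>?K\<^esub> = \<zero>\<^bsub>?K\<^esub>"
        using Suc by (subst add_pow_one_laurent_ring) (auto simp: laurent_ring_simps(4) fun_eq_iff)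
      then show "[m] \<cdot>\<^bsub>laurent_ring ?K\<^esub> \<one>\<^bsub>laurent_ring ?K\<^esub> = \<zero>\<^bsub>laurent_ring ?K\<^esub> \<longleftrightarrow> p dvd m"
        using Suc by (simp add: has_characteristic_def)
    qed
    with Suc show ?case
      by (auto simp: iterated_laurent_def field_laurent_ring)
  qed
  then show "field (iterated_laurent L n)" "has_characteristic (iterated_laurent L n) p"
    by auto
qed

section \<open>Definable sets\<close>

text \<open>Renaming of the variables in terms and formulas, by one map of indices for each sort.\<close>

primrec rename_fterm :: "(nat \<Rightarrow> nat) \<Rightarrow> fterm \<Rightarrow> fterm" where
  "rename_fterm \<pi> (FVar i) = FVar (\<pi> i)"
| "rename_fterm \<pi> FZero = FZero"
| "rename_fterm \<pi> FOne = FOne"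
| "rename_fterm \<pi> (FAdd s t) = FAdd (rename_fterm \<pi> s) (rename_fterm \<pi> t)"
| "rename_fterm \<pi> (FUminus t) = FUminus (rename_fterm \<pi> t)"
| "rename_fterm \<pi> (FMult s t) = FMult (rename_fterm \<pi> s) (rename_fterm \<pi> t)"

primrec rename_rterm :: "(nat \<Rightarrow> nat) \<Rightarrow> (nat \<Rightarrow> nat) \<Rightarrow> 'rf rterm \<Rightarrow> 'rf rterm" where
  "rename_rterm \<pi> \<pi>\<^sub>k (RVar i) = RVar (\<pi>\<^sub>k i)"
| "rename_rterm \<pi> \<pi>\<^sub>k RZero = RZero"
| "rename_rterm \<pi> \<pi>\<^sub>k ROne = ROne"
| "rename_rterm \<pi> \<pi>\<^sub>k (RAdd s t) = RAdd (rename_rterm \<pi> \<pi>\<^sub>k s) (rename_rterm \<pi> \<pi>\<^sub>k t)"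
| "rename_rterm \<pi> \<pi>\<^sub>k (RUminus t) = RUminus (rename_rterm \<pi> \<pi>\<^sub>k t)"
| "rename_rterm \<pi> \<pi>\<^sub>k (RMult s t) = RMult (rename_rterm \<pi> \<pi>\<^sub>k s) (rename_rterm \<pi> \<pi>\<^sub>k t)"
| "rename_rterm \<pi> \<pi>\<^sub>k (RFun f ts) = RFun f (map (rename_rterm \<pi> \<pi>\<^sub>k) ts)"
| "rename_rterm \<pi> \<pi>\<^sub>k (RAc t) = RAc (rename_fterm \<pi> t)"

primrec rename_gterm :: "(nat \<Rightarrow> nat) \<Rightarrow> (nat \<Rightarrow> nat) \<Rightarrow> 'gf gterm \<Rightarrow> 'gf gterm" where
  "rename_gterm \<pi> \<pi>\<^sub>G (GVar i) = GVar (\<pi>\<^sub>G i)"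
| "rename_gterm \<pi> \<pi>\<^sub>G GZero = GZero"
| "rename_gterm \<pi> \<pi>\<^sub>G GInf = GInf"
| "rename_gterm \<pi> \<pi>\<^sub>G (GAdd s t) = GAdd (rename_gterm \<pi> \<pi>\<^sub>G s) (rename_gterm \<pi> \<pi>\<^sub>G t)"
| "rename_gterm \<pi> \<pi>\<^sub>G (GUminus t) = GUminus (rename_gterm \<pi> \<pi>\<^sub>G t)"
| "rename_gterm \<pi> \<pi>\<^sub>G (GFun f ts) = GFun f (map (rename_gterm \<pi> \<pi>\<^sub>G) ts)"
| "rename_gterm \<pi> \<pi>\<^sub>G (GVal t) = GVal (rename_fterm \<pi> t)"

text \<open>All variables are renamed, the bound ones included, so that for injective renamings no
  variable is captured.\<close>

primrec rename_formula ::
    "(nat \<Rightarrow> nat) \<Rightarrow> (nat \<Rightarrow> nat) \<Rightarrow> (nat \<Rightarrow> nat) \<Rightarrow>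
     ('rf, 'rr, 'gf, 'gr) pas_formula \<Rightarrow> ('rf, 'rr, 'gf, 'gr) pas_formula" where
  "rename_formula \<pi> \<pi>\<^sub>k \<pi>\<^sub>G (FEq s t) = FEq (rename_fterm \<pi> s) (rename_fterm \<pi> t)"
| "rename_formula \<pi> \<pi>\<^sub>k \<pi>\<^sub>G (REq s t) = REq (rename_rterm \<pi> \<pi>\<^sub>k s) (rename_rterm \<pi> \<pi>\<^sub>k t)"
| "rename_formula \<pi> \<pi>\<^sub>k \<pi>\<^sub>G (RRel r ts) = RRel r (map (rename_rterm \<pi> \<pi>\<^sub>k) ts)"
| "rename_formula \<pi> \<pi>\<^sub>k \<pi>\<^sub>G (GEq s t) = GEq (rename_gterm \<pi> \<pi>\<^sub>G s) (rename_gterm \<pi> \<pi>\<^sub>G t)"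
| "rename_formula \<pi> \<pi>\<^sub>k \<pi>\<^sub>G (GLe s t) = GLe (rename_gterm \<pi> \<pi>\<^sub>G s) (rename_gterm \<pi> \<pi>\<^sub>G t)"
| "rename_formula \<pi> \<pi>\<^sub>k \<pi>\<^sub>G (GRel r ts) = GRel r (map (rename_gterm \<pi> \<pi>\<^sub>G) ts)"
| "rename_formula \<pi> \<pi>\<^sub>k \<pi>\<^sub>G (Neg \<phi>) = Neg (rename_formula \<pi> \<pi>\<^sub>k \<pi>\<^sub>G \<phi>)"
| "rename_formula \<pi> \<pi>\<^sub>k \<pi>\<^sub>G (Conj \<phi> \<psi>) =
     Conj (rename_formula \<pi> \<pi>\<^sub>k \<pi>\<^sub>G \<phi>) (rename_formula \<pi> \<pi>\<^sub>k \<pi>\<^sub>G \<psi>)"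
| "rename_formula \<pi> \<pi>\<^sub>k \<pi>\<^sub>G (FEx i \<phi>) = FEx (\<pi> i) (rename_formula \<pi> \<pi>\<^sub>k \<pi>\<^sub>G \<phi>)"
| "rename_formula \<pi> \<pi>\<^sub>k \<pi>\<^sub>G (REx i \<phi>) = REx (\<pi>\<^sub>k i) (rename_formula \<pi> \<pi>\<^sub>k \<pi>\<^sub>G \<phi>)"
| "rename_formula \<pi> \<pi>\<^sub>k \<pi>\<^sub>G (GEx i \<phi>) = GEx (\<pi>\<^sub>G i) (rename_formula \<pi> \<pi>\<^sub>k \<pi>\<^sub>G \<phi>)"

lemma feval_rename: "feval K \<rho> (rename_fterm \<pi> t) = feval K (\<rho> \<circ> \<pi>) t"
  by (induction t) auto

lemma reval_rename: "reval S \<rho> \<sigma> (rename_rterm \<pi> \<pi>\<^sub>k t) = reval S (\<rho> \<circ> \<pi>) (\<sigma> \<circ> \<pi>\<^sub>k) t"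
  by (induction t) (auto simp: feval_rename comp_def cong: map_cong)

lemma geval_rename: "geval S \<rho> \<gamma> (rename_gterm \<pi> \<pi>\<^sub>G t) = geval S (\<rho> \<circ> \<pi>) (\<gamma> \<circ> \<pi>\<^sub>G) t"
  by (induction t) (auto simp: feval_rename comp_def cong: map_cong)

lemma rterm_wf_rename: "rterm_wf E (rename_rterm \<pi> \<pi>\<^sub>k t) = rterm_wf E t"
  by (induction t) auto

lemma gterm_wf_rename: "gterm_wf E (rename_gterm \<pi> \<pi>\<^sub>G t) = gterm_wf E t"
  by (induction t) auto

lemma pas_formula_wf_rename: "pas_formula_wf S (rename_formula \<pi> \<pi>\<^sub>k \<pi>\<^sub>G \<phi>) = pas_formula_wf S \<phi>"
  by (induction \<phi>) (auto simp: rterm_wf_rename gterm_wf_rename)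

lemma fun_upd_comp_inj: "inj \<pi> \<Longrightarrow> f(\<pi> i := x) \<circ> \<pi> = (f \<circ> \<pi>)(i := x)"
  by (auto simp: fun_eq_iff inj_eq)

lemma pas_sat_rename:
  assumes "inj \<pi>" "inj \<pi>\<^sub>k" "inj \<pi>\<^sub>G"
  shows "pas_sat S \<rho> \<sigma> \<gamma> (rename_formula \<pi> \<pi>\<^sub>k \<pi>\<^sub>G \<phi>) =
    pas_sat S (\<rho> \<circ> \<pi>) (\<sigma> \<circ> \<pi>\<^sub>k) (\<gamma> \<circ> \<pi>\<^sub>G) \<phi>"
proof -
  have "reval S \<rho> \<sigma> \<circ> rename_rterm \<pi> \<pi>\<^sub>k = reval S (\<rho> \<circ> \<pi>) (\<sigma> \<circ> \<pi>\<^sub>k)"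
    and "geval S \<rho> \<gamma> \<circ> rename_gterm \<pi> \<pi>\<^sub>G = geval S (\<rho> \<circ> \<pi>) (\<gamma> \<circ> \<pi>\<^sub>G)" for \<rho> \<sigma> \<gamma>
    by (simp_all add: fun_eq_iff reval_rename geval_rename)
  then show ?thesis
    by (induction \<phi> arbitrary: \<rho> \<sigma> \<gamma>)
      (simp_all add: feval_rename reval_rename geval_rename fun_upd_comp_inj assms)
qed

lemma cart_power_nth: "xs \<in> cart_power U m \<Longrightarrow> i < m \<Longrightarrow> xs ! i \<in> U"
  by (auto simp: cart_power_def)

lemma cart_power_snoc: "xs @ [x] \<in> cart_power U (Suc m) \<longleftrightarrow> xs \<in> cart_power U m \<and> x \<in> U"
  by (auto simp: cart_power_def)

lemma cart_power_append:
  "xs \<in> cart_power U m \<Longrightarrow> ys \<in> cart_power U n \<Longrightarrow> xs @ ys \<in> cart_power U (m + n)"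
  by (auto simp: cart_power_def)

lemma definableI:
  assumes "pas_formula_wf S \<phi>" "range \<rho> \<subseteq> carrier (valued_field S)"
    "range \<sigma> \<subseteq> carrier (residue_sort S)" "range \<gamma> \<subseteq> zgroup_inf (value_rank S)"
    and "\<And>xs. xs \<in> A \<Longrightarrow> xs \<in> cart_power (carrier (valued_field S)) m"
    and "\<And>xs. xs \<in> cart_power (carrier (valued_field S)) m \<Longrightarrow>
      pas_sat S (\<lambda>i. if i < m then xs ! i else \<rho> i) \<sigma> \<gamma> \<phi> \<longleftrightarrow> xs \<in> A"
  shows "definable S m A"
  unfolding definable_def
  by (rule exI[of _ \<phi>], rule exI[of _ \<rho>], rule exI[of _ \<sigma>], rule exI[of _ \<gamma>]) (use assms in auto)

lemma definableE:
  assumes "definable S m A"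
  obtains \<phi> \<rho> \<sigma> \<gamma> where "pas_formula_wf S \<phi>" "range \<rho> \<subseteq> carrier (valued_field S)"
    "range \<sigma> \<subseteq> carrier (residue_sort S)" "range \<gamma> \<subseteq> zgroup_inf (value_rank S)"
    and "A = {xs \<in> cart_power (carrier (valued_field S)) m.
      pas_sat S (\<lambda>i. if i < m then xs ! i else \<rho> i) \<sigma> \<gamma> \<phi>}"
  using assms unfolding definable_def by blast

lemma definable_subset: "definable S m A \<Longrightarrow> A \<subseteq> cart_power (carrier (valued_field S)) m"
  unfolding definable_def by blast

lemma definable_Collect:
  assumes "pas_formula_wf S \<phi>" "c \<in> carrier (valued_field S)" "carrier (residue_sort S) \<noteq> {}"
  shows "definable S m {xs \<in> cart_power (carrier (valued_field S)) m.
    pas_sat S (\<lambda>i. if i < m then xs ! i else c) (\<lambda>_. SOME a. a \<in> carrier (residue_sort S)) (\<lambda>_. None) \<phi>}"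
proof (rule definableI)
  show "range (\<lambda>_::nat. SOME a. a \<in> carrier (residue_sort S)) \<subseteq> carrier (residue_sort S)"
    using assms(3) by (auto simp: some_in_eq)
qed (use assms in \<open>auto simp: zgroup_inf_def\<close>)

lemma definable_Diff:
  assumes "definable S m A"
  shows "definable S m (cart_power (carrier (valued_field S)) m - A)"
  using assms
proof (rule definableE)
  fix \<phi> \<rho> \<sigma> \<gamma> assume *: "pas_formula_wf S \<phi>" "range \<rho> \<subseteq> carrier (valued_field S)"
    "range \<sigma> \<subseteq> carrier (residue_sort S)" "range \<gamma> \<subseteq> zgroup_inf (value_rank S)"
    "A = {xs \<in> cart_power (carrier (valued_field S)) m.
      pas_sat S (\<lambda>i. if i < m then xs ! i else \<rho> i) \<sigma> \<gamma> \<phi>}"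
  show ?thesis
    by (rule definableI[of _ "Neg \<phi>" \<rho> \<sigma> \<gamma>]) (use * in auto)
qed

text \<open>The parameters of two formulas are kept apart by moving those of the first to the variables
  with even distance from the coordinates of the point, and those of the second to the others.\<close>

lemma definable_Int:
  assumes "definable S m A" "definable S m B"
  shows "definable S m (A \<inter> B)"
  using assms(1)
proof (rule definableE)
  fix \<phi> \<rho> \<sigma> \<gamma> assume A: "pas_formula_wf S \<phi>" "range \<rho> \<subseteq> carrier (valued_field S)"
    "range \<sigma> \<subseteq> carrier (residue_sort S)" "range \<gamma> \<subseteq> zgroup_inf (value_rank S)"
    "A = {xs \<in> cart_power (carrier (valued_field S)) m.
      pas_sat S (\<lambda>i. if i < m then xs ! i else \<rho> i) \<sigma> \<gamma> \<phi>}"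
  show ?thesis using assms(2)
  proof (rule definableE)
    fix \<phi>' \<rho>' \<sigma>' \<gamma>' assume B: "pas_formula_wf S \<phi>'" "range \<rho>' \<subseteq> carrier (valued_field S)"
      "range \<sigma>' \<subseteq> carrier (residue_sort S)" "range \<gamma>' \<subseteq> zgroup_inf (value_rank S)"
      "B = {xs \<in> cart_power (carrier (valued_field S)) m.
        pas_sat S (\<lambda>i. if i < m then xs ! i else \<rho>' i) \<sigma>' \<gamma>' \<phi>'}"
    define e where "e j i = (if i < m then i else m + (2 * (i - m) + j))" for i j :: nat
    define \<epsilon> where "\<epsilon> j i = 2 * i + j" for i j :: nat
    have inj_e: "inj (e j)" for j
      by (rule injI) (auto simp: e_def split: if_splits)
    have inj_\<epsilon>: "inj (\<epsilon> j)" for j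
      by (rule injI) (auto simp: \<epsilon>_def)
    define \<rho>'' where "\<rho>'' i = (if even (i - m) then \<rho> (m + (i - m) div 2) else \<rho>' (m + (i - m) div 2))" for i
    define \<sigma>'' where "\<sigma>'' i = (if even i then \<sigma> (i div 2) else \<sigma>' (i div 2))" for i
    define \<gamma>'' where "\<gamma>'' i = (if even i then \<gamma> (i div 2) else \<gamma>' (i div 2))" for i
    have \<sigma>: "\<sigma>'' \<circ> \<epsilon> 0 = \<sigma>" "\<sigma>'' \<circ> \<epsilon> 1 = \<sigma>'" and \<gamma>: "\<gamma>'' \<circ> \<epsilon> 0 = \<gamma>" "\<gamma>'' \<circ> \<epsilon> 1 = \<gamma>'"
      by (auto simp: \<sigma>''_def \<gamma>''_def \<epsilon>_def fun_eq_iff)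
    have \<rho>: "(\<lambda>i. if i < m then xs ! i else \<rho>'' i) \<circ> e 0 = (\<lambda>i. if i < m then xs ! i else \<rho> i)"
      "(\<lambda>i. if i < m then xs ! i else \<rho>'' i) \<circ> e 1 = (\<lambda>i. if i < m then xs ! i else \<rho>' i)" for xs
      by (auto simp: \<rho>''_def e_def fun_eq_iff)
    show ?thesis
    proof (rule definableI[of _ "Conj (rename_formula (e 0) (\<epsilon> 0) (\<epsilon> 0) \<phi>)
          (rename_formula (e 1) (\<epsilon> 1) (\<epsilon> 1) \<phi>')" \<rho>'' \<sigma>'' \<gamma>''])
      show "range \<rho>'' \<subseteq> carrier (valued_field S)" "range \<sigma>'' \<subseteq> carrier (residue_sort S)"
        "range \<gamma>'' \<subseteq> zgroup_inf (value_rank S)"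
        using A(2-4) B(2-4) by (simp_all add: image_subset_iff \<rho>''_def \<sigma>''_def \<gamma>''_def)
    qed (use A B in \<open>auto simp: pas_formula_wf_rename pas_sat_rename inj_e inj_\<epsilon> \<rho> \<sigma> \<gamma> simp del: One_nat_def\<close>)
  qed
qed

text \<open>The preimage of a definable set under a map that selects distinct coordinates. The parameters
  of the formula are moved beyond the new coordinates.\<close>

lemma definable_reindex:
  assumes "definable S m A" "inj_on f {..<m}" "f ` {..<m} \<subseteq> {..<n}"
  shows "definable S n {xs \<in> cart_power (carrier (valued_field S)) n. map (\<lambda>i. xs ! f i) [0..<m] \<in> A}"
  using assms(1)
proof (rule definableE)
  fix \<phi> \<rho> \<sigma> \<gamma> assume A: "pas_formula_wf S \<phi>" "range \<rho> \<subseteq> carrier (valued_field S)"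
    "range \<sigma> \<subseteq> carrier (residue_sort S)" "range \<gamma> \<subseteq> zgroup_inf (value_rank S)"
    "A = {xs \<in> cart_power (carrier (valued_field S)) m.
      pas_sat S (\<lambda>i. if i < m then xs ! i else \<rho> i) \<sigma> \<gamma> \<phi>}"
  define e where "e i = (if i < m then f i else n + i)" for i
  have f: "f i < n" if "i < m" for i
    using assms(3) that by auto
  have inj_e: "inj e"
  proof (rule injI)
    fix i j assume "e i = e j"
    then show "i = j"
      using assms(2) f[of i] f[of j] by (auto simp: e_def inj_on_def split: if_splits)
  qed
  have \<rho>: "(\<lambda>i. if i < n then xs ! i else \<rho> (i - n)) \<circ> e =
      (\<lambda>i. if i < m then map (\<lambda>i. xs ! f i) [0..<m] ! i else \<rho> i)" for xs
    using f by (auto simp: e_def fun_eq_iff)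
  show ?thesis
  proof (rule definableI[of _ "rename_formula e id id \<phi>" "\<lambda>i. \<rho> (i - n)" \<sigma> \<gamma>])
    fix xs assume xs: "xs \<in> cart_power (carrier (valued_field S)) n"
    have "map (\<lambda>i. xs ! f i) [0..<m] \<in> cart_power (carrier (valued_field S)) m"
      using cart_power_nth[OF xs f] by (auto simp: cart_power_def)
    with xs show "pas_sat S (\<lambda>i. if i < n then xs ! i else \<rho> (i - n)) \<sigma> \<gamma> (rename_formula e id id \<phi>) \<longleftrightarrow>
        xs \<in> {xs \<in> cart_power (carrier (valued_field S)) n. map (\<lambda>i. xs ! f i) [0..<m] \<in> A}"
      by (simp add: pas_sat_rename inj_e \<rho> A(5) del: map_eq_conv)
  qed (use A in \<open>auto simp: pas_formula_wf_rename\<close>)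
qed

text \<open>Structures in which the variables of every sort can be assigned a value: the ring contains zero,
  the value group sort always contains \<open>\<infinity>\<close>, and the residue field sort is assumed to be inhabited.\<close>

locale inhabited_pas =
  fixes S :: "('a, 'rf, 'rr, 'gf, 'gr) pas_structure"
  assumes ring_valued_field: "ring (valued_field S)"
    and residue_sort_nonempty: "carrier (residue_sort S) \<noteq> {}"
begin

abbreviation "C \<equiv> carrier (valued_field S)"
abbreviation "z \<equiv> \<zero>\<^bsub>valued_field S\<^esub>"

lemma zero_closed: "z \<in> C"
  using ring_valued_field by (simp add: ring.ring_simprules)

lemma definable_coordinates_eq:
  assumes "i < m" "j < m"
  shows "definable S m {xs \<in> cart_power C m. xs ! i = xs ! j}"
  using definable_Collect[OF _ zero_closed residue_sort_nonempty, of "FEq (FVar i) (FVar j)" m] assms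
  by simp

lemma definable_coordinate_zero:
  assumes "i < m"
  shows "definable S m {xs \<in> cart_power C m. xs ! i = z}"
  using definable_Collect[OF _ zero_closed residue_sort_nonempty, of "FEq (FVar i) FZero" m] assms
  by simp

lemma definable_UNIV: "definable S m (cart_power C m)"
  using definable_Collect[OF _ zero_closed residue_sort_nonempty, of "FEq FZero FZero" m]
  by simp

lemma definable_blocks_eq:
  assumes "d + r \<le> m" "r \<le> m"
  shows "definable S m {xs \<in> cart_power C m. \<forall>i<r. xs ! i = xs ! (d + i)}"
  using assms
proof (induction r)
  case 0
  then show ?case using definable_UNIV by simp
next
  case (Suc r)
  have "{xs \<in> cart_power C m. \<forall>i<Suc r. xs ! i = xs ! (d + i)} =
      {xs \<in> cart_power C m. \<forall>i<r. xs ! i = xs ! (d + i)} \<inter> {xs \<in> cart_power C m. xs ! r = xs ! (d + r)}"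
    by (auto simp: less_Suc_eq)
  then show ?case
    using Suc by (auto intro!: definable_Int definable_coordinates_eq)
qed

lemma map_nth_upt_eq_take: "m \<le> length xs \<Longrightarrow> map (\<lambda>i. xs ! i) [0..<m] = take m xs"
  by (auto intro!: nth_equalityI)

lemma definable_take:
  assumes "definable S m A" "m \<le> n"
  shows "definable S n {xs \<in> cart_power C n. take m xs \<in> A}"
proof -
  have "{xs \<in> cart_power C n. map (\<lambda>i. xs ! i) [0..<m] \<in> A} = {xs \<in> cart_power C n. take m xs \<in> A}"
    using assms(2) by (auto simp: map_nth_upt_eq_take cart_power_def)
  then show ?thesis
    using definable_reindex[OF assms(1), of "\<lambda>i. i" n] assms(2) by auto
qed

text \<open>The product of a definable set with a definable subset of the line.\<close>

lemma definable_times_line: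
  assumes "definable S m A" "definable S 1 ((\<lambda>x. [x]) ` X)"
  shows "definable S (Suc m) {xs @ [x] | xs x. xs \<in> A \<and> x \<in> X}"
proof -
  have X: "X \<subseteq> C"
    using definable_subset[OF assms(2)] by (auto simp: cart_power_def)
  have A: "A \<subseteq> cart_power C m"
    by (rule definable_subset[OF assms(1)])
  have "{xs @ [x] | xs x. xs \<in> A \<and> x \<in> X} = {xs \<in> cart_power C (Suc m). take m xs \<in> A} \<inter>
      {xs \<in> cart_power C (Suc m). map (\<lambda>i. xs ! (m + i)) [0..<1] \<in> (\<lambda>x. [x]) ` X}"
    (is "?L = ?R")
  proof (intro equalityI subsetI)
    fix ys assume "ys \<in> ?L"
    then obtain xs x where ys: "ys = xs @ [x]" "xs \<in> A" "x \<in> X" by auto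
    moreover have "xs \<in> cart_power C m" "x \<in> C"
      using X A ys by auto
    moreover from this have "length xs = m"
      by (simp add: cart_power_def)
    ultimately show "ys \<in> ?R"
      by (auto simp: cart_power_snoc nth_append)
  next
    fix ys assume ys: "ys \<in> ?R"
    then have "length ys = Suc m" by (simp add: cart_power_def)
    then have "ys = take m ys @ [ys ! m]"
      by (metis lessI take_Suc_conv_app_nth take_all order.refl)
    with ys show "ys \<in> ?L"
      by (auto simp: inj_image_mem_iff inj_def)
  qed
  moreover have "definable S (Suc m)
      {xs \<in> cart_power C (Suc m). map (\<lambda>i. xs ! (m + i)) [0..<1] \<in> (\<lambda>x. [x]) ` X}"
    by (rule definable_reindex[OF assms(2)]) auto
  ultimately show ?thesis
    using definable_take[OF assms(1), of "Suc m"] by (simp add: definable_Int)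
qed

lemma definable_bij_append_zero:
  assumes "definable S m A" "definable S 1 {[z]}"
  shows "definable_bij S (\<lambda>xs. xs @ [z]) m A (Suc m) {xs @ [z] | xs. xs \<in> A}"
proof -
  have A: "A \<subseteq> cart_power C m"
    by (rule definable_subset[OF assms(1)])
  have "definable S (Suc m) {xs @ [x] | xs x. xs \<in> A \<and> x \<in> {z}}"
    using assms by (intro definable_times_line) auto
  moreover have "{xs @ [x] | xs x. xs \<in> A \<and> x \<in> {z}} = {xs @ [z] | xs. xs \<in> A}"
    by auto
  moreover have "bij_betw (\<lambda>xs. xs @ [z]) A {xs @ [z] | xs. xs \<in> A}"
    by (auto simp: bij_betw_def inj_on_def)
  moreover have "definable S (m + Suc m) {xs @ (xs @ [z]) | xs. xs \<in> A}"
  proof -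
    let ?n = "m + Suc m"
    have "{xs @ (xs @ [z]) | xs. xs \<in> A} = {xs \<in> cart_power C ?n. take m xs \<in> A} \<inter>
        {xs \<in> cart_power C ?n. \<forall>i<m. xs ! i = xs ! (m + i)} \<inter> {xs \<in> cart_power C ?n. xs ! (m + m) = z}"
      (is "?L = ?R")
    proof (intro equalityI subsetI)
      fix ys assume "ys \<in> ?L"
      then obtain xs where ys: "ys = xs @ (xs @ [z])" "xs \<in> A" by auto
      moreover have xs: "xs \<in> cart_power C m"
        using A ys by auto
      moreover have "ys \<in> cart_power C ?n"
        unfolding ys(1) using xs zero_closed by (intro cart_power_append) (simp_all add: cart_power_snoc)
      moreover have "length xs = m"
        using xs by (simp add: cart_power_def)
      ultimately show "ys \<in> ?R"
        by (auto simp: nth_append)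
    next
      fix ys assume ys: "ys \<in> ?R"
      then have len: "length ys = m + Suc m" by (simp add: cart_power_def)
      have "ys = take m ys @ (take m ys @ [z])"
      proof (rule nth_equalityI)
        fix i assume i: "i < length ys"
        consider "i < m" | j where "i = m + j" "j < m" | "i = m + m"
          using i len by (cases "i < m"; cases "i = m + m") (auto intro: that(2)[of "i - m"])
        then show "ys ! i = (take m ys @ (take m ys @ [z])) ! i"
          using ys len by cases (auto simp: nth_append)
      qed (simp add: len)
      with ys show "ys \<in> ?L" by blast
    qed
    then show ?thesis
      using definable_take[OF assms(1), of ?n] definable_blocks_eq[of m m ?n]
        definable_coordinate_zero[of "m + m" ?n]
      by (simp add: definable_Int)
  qed
  ultimately show ?thesis
    using assms(1) by (simp add: definable_bij_def)
qed

text \<open>The product of the identity on a definable set with a definable bijection between subsets of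
  the line.\<close>

lemma definable_bij_times_line:
  assumes "definable S m A" "definable_bij S f 1 ((\<lambda>x. [x]) ` X) 1 ((\<lambda>x. [x]) ` Y)"
  shows "definable_bij S (\<lambda>xs. take m xs @ f (drop m xs))
    (Suc m) {xs @ [x] | xs x. xs \<in> A \<and> x \<in> X} (Suc m) {xs @ [x] | xs x. xs \<in> A \<and> x \<in> Y}"
proof -
  define g where "g x = hd (f [x])" for x
  have X: "definable S 1 ((\<lambda>x. [x]) ` X)" and Y: "definable S 1 ((\<lambda>x. [x]) ` Y)"
    and f: "bij_betw f ((\<lambda>x. [x]) ` X) ((\<lambda>x. [x]) ` Y)"
    and graph: "definable S 2 {xs @ f xs | xs. xs \<in> (\<lambda>x. [x]) ` X}"
    using assms(2) by (auto simp: definable_bij_def numeral_2_eq_2)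
  have A: "A \<subseteq> cart_power C m"
    by (rule definable_subset[OF assms(1)])
  have XC: "X \<subseteq> C" and YC: "Y \<subseteq> C"
    using definable_subset[OF X] definable_subset[OF Y] by (auto simp: cart_power_def)
  have fg: "f [x] = [g x]" "g x \<in> Y" if "x \<in> X" for x
    using bij_betw_apply[OF f, of "[x]"] that by (auto simp: g_def)
  have len: "length xs = m" if "xs \<in> A" for xs
    using that A by (auto simp: cart_power_def)
  have "bij_betw (\<lambda>xs. take m xs @ f (drop m xs))
    {xs @ [x] | xs x. xs \<in> A \<and> x \<in> X} {xs @ [x] | xs x. xs \<in> A \<and> x \<in> Y}"
    unfolding bij_betw_def
  proof
    show "inj_on (\<lambda>xs. take m xs @ f (drop m xs)) {xs @ [x] | xs x. xs \<in> A \<and> x \<in> X}"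
    proof (rule inj_onI)
      fix us vs assume "us \<in> {xs @ [x] | xs x. xs \<in> A \<and> x \<in> X}" "vs \<in> {xs @ [x] | xs x. xs \<in> A \<and> x \<in> X}"
        and eq: "take m us @ f (drop m us) = take m vs @ f (drop m vs)"
      then obtain xs x ys y where *: "us = xs @ [x]" "xs \<in> A" "x \<in> X" "vs = ys @ [y]" "ys \<in> A" "y \<in> X"
        by auto
      then have "xs = ys" "f [x] = f [y]"
        using eq len by (auto simp: fg)
      then show "us = vs"
        using * f by (auto simp: bij_betw_def inj_on_def)
    qed
    show "(\<lambda>xs. take m xs @ f (drop m xs)) ` {xs @ [x] | xs x. xs \<in> A \<and> x \<in> X} =
        {xs @ [x] | xs x. xs \<in> A \<and> x \<in> Y}"
    proof (intro equalityI subsetI)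
      fix us assume "us \<in> {xs @ [x] | xs x. xs \<in> A \<and> x \<in> Y}"
      then obtain ys y where *: "us = ys @ [y]" "ys \<in> A" "y \<in> Y" by auto
      have "f ` (\<lambda>x. [x]) ` X = (\<lambda>x. [x]) ` Y"
        using f by (simp add: bij_betw_def)
      with *(3) have "[y] \<in> f ` (\<lambda>x. [x]) ` X"
        by blast
      then obtain x where "x \<in> X" "f [x] = [y]"
        by (elim imageE) simp
      note x = this
      have "take m (ys @ [x]) @ f (drop m (ys @ [x])) = us"
        using len[OF *(2)] x(2) *(1) by simp
      moreover have "ys @ [x] \<in> {xs @ [x] | xs x. xs \<in> A \<and> x \<in> X}"
        using *(2) x(1) by blast
      ultimately show "us \<in> (\<lambda>xs. take m xs @ f (drop m xs)) ` {xs @ [x] | xs x. xs \<in> A \<and> x \<in> X}"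
        by (metis (no_types, lifting) imageI)
    qed (auto simp: len fg)
  qed
  moreover have "definable S (Suc m + Suc m)
    {xs @ (take m xs @ f (drop m xs)) | xs. xs \<in> {xs @ [x] | xs x. xs \<in> A \<and> x \<in> X}}"
  proof -
    let ?n = "Suc m + Suc m" and ?h = "\<lambda>i. if i = 0 then m else Suc m + m"
    have "{xs @ (take m xs @ f (drop m xs)) | xs. xs \<in> {xs @ [x] | xs x. xs \<in> A \<and> x \<in> X}} =
        {xs \<in> cart_power C ?n. take m xs \<in> A} \<inter>
        {xs \<in> cart_power C ?n. \<forall>i<m. xs ! i = xs ! (Suc m + i)} \<inter>
        {xs \<in> cart_power C ?n. map (\<lambda>i. xs ! ?h i) [0..<2] \<in> {xs @ f xs | xs. xs \<in> (\<lambda>x. [x]) ` X}}"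
      (is "?L = ?R")
    proof (intro equalityI subsetI)
      fix ys assume "ys \<in> ?L"
      then obtain xs x where ys: "ys = (xs @ [x]) @ (xs @ [g x])" "xs \<in> A" "x \<in> X"
        using len by (auto simp: fg)
      have "xs \<in> cart_power C m" "x \<in> C" "g x \<in> C"
        using A XC YC fg(2)[OF ys(3)] ys by auto
      then have "ys \<in> cart_power C ?n"
        unfolding ys(1) by (intro cart_power_append) (simp_all add: cart_power_snoc)
      moreover have "map (\<lambda>i. ys ! ?h i) [0..<2] = [x] @ f [x]"
        using len[OF ys(2)] by (simp add: ys(1) upt_rec nth_append fg(1)[OF ys(3)])
      then have "map (\<lambda>i. ys ! ?h i) [0..<2] \<in> {xs @ f xs | xs. xs \<in> (\<lambda>x. [x]) ` X}"
        using ys(3) by blast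
      moreover have "take m ys = xs" "\<forall>i<m. ys ! i = ys ! (Suc m + i)"
        using len[OF ys(2)] by (auto simp: ys(1) nth_append)
      ultimately show "ys \<in> ?R"
        using ys(2) by simp
    next
      fix ys assume ys: "ys \<in> ?R"
      then have l: "length ys = ?n" by (simp add: cart_power_def)
      obtain x where x: "x \<in> X" "ys ! m = x" "ys ! (Suc m + m) = g x"
        using ys by (auto simp: upt_rec fg)
      have "ys = (take m ys @ [x]) @ (take m ys @ [g x])"
      proof (rule nth_equalityI)
        fix i assume i: "i < length ys"
        consider "i < m" | "i = m" | j where "i = Suc m + j" "j < m" | "i = Suc m + m"
          using i l by (cases "i < m"; cases "i = m"; cases "i = Suc m + m")
            (auto intro: that(3)[of "i - Suc m"])
        then show "ys ! i = ((take m ys @ [x]) @ (take m ys @ [g x])) ! i"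
          using ys l x by cases (auto simp: nth_append)
      qed (simp add: l)
      moreover have A': "take m ys \<in> A" using ys by blast
      then have "take m (take m ys @ [x]) @ f (drop m (take m ys @ [x])) = take m ys @ [g x]"
        using len[OF A'] by (simp add: fg(1)[OF x(1)])
      ultimately have "ys = (take m ys @ [x]) @ (take m (take m ys @ [x]) @ f (drop m (take m ys @ [x])))"
        by presburger
      then show "ys \<in> ?L"
        using x(1) A' by blast
    qed
    moreover have "definable S ?n {xs \<in> cart_power C ?n. map (\<lambda>i. xs ! ?h i) [0..<2] \<in>
        {xs @ f xs | xs. xs \<in> (\<lambda>x. [x]) ` X}}"
      by (rule definable_reindex[OF graph]) (auto simp: inj_on_def)
    ultimately show ?thesis
      using definable_take[OF assms(1), of ?n] definable_blocks_eq[of "Suc m" m ?n]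
      by (simp add: definable_Int)
  qed
  ultimately show ?thesis
    using assms(1) X Y by (simp add: definable_bij_def definable_times_line)
qed

section \<open>Triviality of the Grothendieck ring\<close>

text \<open>The free abelian group on the definable sets and its subgroup of relations.\<close>

abbreviation "F \<equiv> free_Abelian_group (definable_sets S)"
abbreviation "N \<equiv> generate F (grothendieck_relators S)"

lemma relators_subset: "grothendieck_relators S \<subseteq> carrier F"
proof -
  have frag: "frag_of A \<in> carrier F" if "A \<in> definable_sets S" for A
    using that by (simp add: carrier_free_Abelian_group_iff)
  have diff: "a - b \<in> carrier F" "a + b \<in> carrier F" if "a \<in> carrier F" "b \<in> carrier F" for a b
    using that keys_diff[of a b] Poly_Mapping.keys_add[of a b]
    unfolding carrier_free_Abelian_group_iff by blast+
  have "A \<in> definable_sets S \<and> B \<in> definable_sets S" if "definably_isomorphic S A B" for A B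
    using that by (auto simp: definably_isomorphic_def definable_bij_def definable_sets_def)
  then show ?thesis
    unfolding grothendieck_relators_def by (blast intro: frag diff)
qed

lemma generate_closed:
  assumes "a \<in> N" "b \<in> N"
  shows "a - b \<in> N" "a + b \<in> N"
proof -
  interpret G: group F by simp
  have c: "a \<in> carrier F" "b \<in> carrier F"
    using assms G.generate_incl[OF relators_subset] by blast+
  interpret H: subgroup N F
    by (rule G.generate_is_subgroup[OF relators_subset])
  show "a + b \<in> N" using H.m_closed[OF assms] by simp
  have "- b \<in> N" using H.m_inv_closed[OF assms(2)] c by simp
  then show "a - b \<in> N" using H.m_closed[OF assms(1)] by force
qed

text \<open>For a definable set \<open>A\<close>, the products of \<open>A\<close> with the line and with the punctured line have the
  same class, and they differ by \<open>A \<times> {0}\<close>, which is isomorphic to \<open>A\<close>. So every generator is zero.\<close>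

theorem grothendieck_ring_trivial:
  assumes "definable_bij S f 1 (cart_power C 1) 1 (cart_power (C - {z}) 1)"
  shows "carrier (grothendieck_ring S) = {\<zero>\<^bsub>grothendieck_ring S\<^esub>}"
proof -
  interpret G: group F by simp
  have line: "cart_power U 1 = (\<lambda>x. [x]) ` U" for U :: "'a set"
    by (auto simp: cart_power_def length_Suc_conv numeral_eq_Suc)
  have "{[z]} = cart_power C 1 - cart_power (C - {z}) 1"
    unfolding line using zero_closed by auto
  then have z: "definable S 1 {[z]}"
    using assms by (auto simp: definable_bij_def intro: definable_Diff)
  have frag: "frag_of A \<in> N" if A: "definable S m A" "m > 0" for A m
  proof -
    let ?AK = "{xs @ [x] | xs x. xs \<in> A \<and> x \<in> C}" and ?AK' = "{xs @ [x] | xs x. xs \<in> A \<and> x \<in> C - {z}}"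
    let ?A0 = "{xs @ [z] | xs. xs \<in> A}"
    have b1: "definable_bij S (\<lambda>xs. take m xs @ f (drop m xs)) (Suc m) ?AK (Suc m) ?AK'"
      using assms by (intro definable_bij_times_line[OF A(1)]) (simp only: line)
    have b2: "definable_bij S (\<lambda>xs. xs @ [z]) m A (Suc m) ?A0"
      by (rule definable_bij_append_zero[OF A(1) z])
    have "definably_isomorphic S ?AK ?AK'" "definably_isomorphic S A ?A0"
      using b1 b2 A(2) unfolding definably_isomorphic_def by blast+
    then have r1: "frag_of ?AK - frag_of ?AK' \<in> N" "frag_of A - frag_of ?A0 \<in> N"
      by (auto simp: grothendieck_relators_def intro!: generate.incl)
    have "?AK = ?AK' \<union> ?A0" "?AK' \<inter> ?A0 = {}"
      using zero_closed by auto
    moreover have "?AK \<in> definable_sets S" "?AK' \<in> definable_sets S" "?A0 \<in> definable_sets S"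
      using b1 b2 unfolding definable_bij_def definable_sets_def by blast+
    ultimately have r2: "frag_of ?AK - (frag_of ?AK' + frag_of ?A0) \<in> N"
      by (intro generate.incl) (auto simp: grothendieck_relators_def)
    have "frag_of A = (frag_of A - frag_of ?A0) +
        ((frag_of ?AK - frag_of ?AK') - (frag_of ?AK - (frag_of ?AK' + frag_of ?A0)))"
      by simp
    also have "\<dots> \<in> N"
      by (intro generate_closed r1 r2)
    finally show ?thesis .
  qed
  have "c \<in> N" if "c \<in> carrier F" for c
  proof -
    have "Poly_Mapping.keys c \<subseteq> definable_sets S"
      using that by (simp add: carrier_free_Abelian_group_iff)
    then show ?thesis
    proof (induction c rule: frag_induction)
      case zero
      show ?case using generate.one[of F "grothendieck_relators S"] by simp
    next
      case (one x)
      then show ?case using frag by (auto simp: definable_sets_def)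
    next
      case (diff a b)
      then show ?case by (simp add: generate_closed)
    qed
  qed
  then have N: "N = carrier F"
    using G.generate_incl[OF relators_subset] by auto
  have coset: "N +>\<^bsub>definable_free_ring S\<^esub> c = N" if "c \<in> carrier F" for c
  proof -
    have "N +>\<^bsub>definable_free_ring S\<^esub> c = {a + c | a. a \<in> N}"
      by (auto simp: a_r_coset_def' definable_free_ring_def)
    also have "\<dots> = N"
    proof (intro equalityI subsetI)
      fix a assume "a \<in> N"
      then have "a - c \<in> N" "a = (a - c) + c"
        using that N generate_closed by auto
      then show "a \<in> {a + c | a. a \<in> N}" by blast
    next
      fix b assume "b \<in> {a + c | a. a \<in> N}"
      then obtain a where "a \<in> N" "b = a + c" by blast
      then show "b \<in> N"
        using generate_closed(2)[of a c] that N by simp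
    qed
    finally show ?thesis .
  qed
  have "carrier (grothendieck_ring S) = (\<lambda>c. N +>\<^bsub>definable_free_ring S\<^esub> c) ` carrier F"
    by (auto simp: grothendieck_ring_def FactRing_def A_RCOSETS_def' definable_free_ring_def)
  also have "\<dots> = {N}"
    using coset G.one_closed by force
  finally show ?thesis
    by (simp add: grothendieck_ring_def FactRing_def)
qed

end

section \<open>The Frobenius map\<close>

theorem (in cring) binomial_expansion:
  assumes a: "a \<in> carrier R" and b: "b \<in> carrier R"
  shows "(a \<oplus> b) [^] (n::nat) = (\<Oplus>k\<in>{..n}. [(n choose k)] \<cdot> (a [^] k \<otimes> b [^] (n - k)))"
proof (induction n)
  case 0
  show ?case using a b by simp
next
  case (Suc n)
  let ?x = "\<Oplus>k\<in>{..n}. [(n choose k)] \<cdot> (a [^] Suc k \<otimes> b [^] (n - k))"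
  let ?y = "\<Oplus>k\<in>{..n}. [(n choose Suc k)] \<cdot> (a [^] Suc k \<otimes> b [^] (n - k))"
  have [simp]: "?x \<in> carrier R" "?y \<in> carrier R"
    using a b by (auto intro!: finsum_closed)
  have "(\<Oplus>k\<in>{..n}. [(n choose k)] \<cdot> (a [^] k \<otimes> b [^] (n - k))) \<otimes> a = ?x"
    using a b by (subst finsum_ldistr) (auto intro!: finsum_cong' simp: add_pow_ldistr add_pow_rdistr m_ac)
  moreover have "(\<Oplus>k\<in>{..n}. [(n choose k)] \<cdot> (a [^] k \<otimes> b [^] (n - k))) \<otimes> b = ?y \<oplus> b [^] Suc n"
  proof -
    have "(\<Oplus>k\<in>{..n}. [(n choose k)] \<cdot> (a [^] k \<otimes> b [^] (n - k))) \<otimes> b =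
        (\<Oplus>k\<in>{..n}. [(n choose k)] \<cdot> (a [^] k \<otimes> b [^] (Suc n - k)))"
      using a b by (subst finsum_ldistr) (auto intro!: finsum_cong' simp: add_pow_ldistr m_assoc Suc_diff_le)
    also have "\<dots> = (\<Oplus>k\<in>{..Suc n}. [(n choose k)] \<cdot> (a [^] k \<otimes> b [^] (Suc n - k)))"
      using a b by (subst finsum_Suc) (auto simp: binomial_eq_0)
    also have "\<dots> = ?y \<oplus> b [^] Suc n"
      using a b by (subst finsum_Suc2) auto
    finally show ?thesis .
  qed
  ultimately have "(a \<oplus> b) [^] Suc n = ?x \<oplus> (?y \<oplus> b [^] Suc n)"
    using a b by (simp add: Suc r_distr)
  also have "\<dots> = (\<Oplus>k\<in>{..n}. [(Suc n choose Suc k)] \<cdot> (a [^] Suc k \<otimes> b [^] (n - k))) \<oplus> b [^] Suc n"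
    using a b by (simp add: a_assoc[symmetric] finsum_addf[symmetric] add.nat_pow_mult del: nat_pow_Suc)
  also have "\<dots> = (\<Oplus>k\<in>{..Suc n}. [(Suc n choose k)] \<cdot> (a [^] k \<otimes> b [^] (Suc n - k)))"
    using a b by (subst finsum_Suc2) auto
  finally show ?case .
qed

lemma (in domain) prime_characteristic:
  assumes "has_characteristic R p" "p > 0"
  shows "prime p"
  unfolding prime_nat_iff
proof (intro conjI allI impI)
  have char: "[n] \<cdot> \<one> = \<zero> \<longleftrightarrow> p dvd n" for n :: nat
    using assms(1) by (simp add: has_characteristic_def)
  have "p \<noteq> 1"
    using char[of 1] by auto
  then show "1 < p" using assms(2) by simp
  fix m assume "m dvd p"
  then obtain l where l: "p = m * l" by blast
  have "([m] \<cdot> \<one>) \<otimes> ([l] \<cdot> \<one>) = [p] \<cdot> \<one>"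
    by (simp add: add_pow_ldistr l add.nat_pow_pow mult.commute)
  also have "\<dots> = \<zero>"
    using char by simp
  finally have "[m] \<cdot> \<one> = \<zero> \<or> [l] \<cdot> \<one> = \<zero>"
    by (simp add: integral_iff)
  then have "p dvd m \<or> p dvd l"
    using char by simp
  then show "m = 1 \<or> m = p"
    using \<open>m dvd p\<close> l assms(2) by (metis dvd_antisym dvd_mult_cancel2 dvd_triv_right gr0I mult_0_right)
qed

lemma (in cring) freshmans_dream_char:
  fixes p :: nat
  assumes "prime p" "[p] \<cdot> \<one> = \<zero>" "a \<in> carrier R" "b \<in> carrier R"
  shows "(a \<oplus> b) [^] p = a [^] p \<oplus> b [^] p"
proof -
  let ?f = "\<lambda>k. [(p choose k)] \<cdot> (a [^] k \<otimes> b [^] (p - k))"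
  have p: "p \<noteq> 0"
    using assms(1) by auto
  have zero: "?f k = \<zero>" if "k \<noteq> 0" "k < p" for k
  proof -
    have "p dvd p choose k"
      using that assms(1) by (intro dvd_choose_prime) auto
    then obtain q where q: "p choose k = p * q" by blast
    have "[(p * q)] \<cdot> \<one> = [q] \<cdot> ([p] \<cdot> \<one>)"
      by (simp add: add.nat_pow_pow)
    then have "[(p * q)] \<cdot> \<one> = \<zero>"
      by (simp add: assms(2))
    moreover have "?f k = ([(p choose k)] \<cdot> \<one>) \<otimes> (a [^] k \<otimes> b [^] (p - k))"
      using assms by (simp add: add_pow_ldistr)
    ultimately show ?thesis
      using assms by (simp add: q)
  qed
  have "(a \<oplus> b) [^] p = (\<Oplus>k\<in>{..p}. ?f k)"
    by (rule binomial_expansion[OF assms(3,4)])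
  also have "\<dots> = (\<Oplus>k\<in>{0, p}. ?f k)"
    by (rule add.finprod_mono_neutral_cong_right) (use assms zero in auto)
  also have "\<dots> = a [^] p \<oplus> b [^] p"
    using assms p by (simp add: a_comm)
  finally show ?thesis .
qed

section \<open>A bijection from the line to the punctured line\<close>

text \<open>A field with a valuation ring \<open>V\<close> whose maximal ideal is generated by \<open>t\<close>. The value group
  need not be the integers: only \<open>t\<close> has to have the least positive value.\<close>

locale uniformized_field = field K for K (structure) +
  fixes V :: "'a set" and t :: 'a
  assumes V_subset: "V \<subseteq> carrier K"
    and V_one: "\<one> \<in> V"
    and V_add: "x \<in> V \<Longrightarrow> y \<in> V \<Longrightarrow> x \<oplus> y \<in> V"
    and V_uminus: "x \<in> V \<Longrightarrow> \<ominus> x \<in> V"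
    and V_mult: "x \<in> V \<Longrightarrow> y \<in> V \<Longrightarrow> x \<otimes> y \<in> V"
    and V_valuation: "x \<in> carrier K \<Longrightarrow> x \<noteq> \<zero> \<Longrightarrow> x \<in> V \<or> inv x \<in> V"
    and t_in_V: "t \<in> V"
    and t_nonzero: "t \<noteq> \<zero>"
    and inv_t_notin_V: "inv t \<notin> V"
    and nonunit_div_t: "x \<in> V \<Longrightarrow> x \<noteq> \<zero> \<Longrightarrow> inv x \<notin> V \<Longrightarrow> inv t \<otimes> x \<in> V"
begin

text \<open>The maximal ideal, which is \<open>t V\<close>.\<close>

definition M :: "'a set" where
  "M = {x \<in> carrier K. inv t \<otimes> x \<in> V}"

lemma field_inv [simp]:
  assumes "a \<in> carrier K" "a \<noteq> \<zero>"
  shows "inv a \<in> carrier K" "a \<otimes> inv a = \<one>" "inv a \<otimes> a = \<one>" "inv a \<noteq> \<zero>" "inv (inv a) = a"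
    and "b \<in> carrier K \<Longrightarrow> a \<otimes> (inv a \<otimes> b) = b" "b \<in> carrier K \<Longrightarrow> inv a \<otimes> (a \<otimes> b) = b"
proof -
  have u: "a \<in> Units K" using assms by (simp add: field_Units)
  then show 1: "inv a \<in> carrier K" "a \<otimes> inv a = \<one>" "inv a \<otimes> a = \<one>" "inv (inv a) = a"
    by auto
  then show "inv a \<noteq> \<zero>" using assms(1) by auto
  show "b \<in> carrier K \<Longrightarrow> a \<otimes> (inv a \<otimes> b) = b" "b \<in> carrier K \<Longrightarrow> inv a \<otimes> (a \<otimes> b) = b"
    using 1 assms by (simp_all flip: m_assoc)
qed

lemma inv_mult:
  assumes "a \<in> carrier K" "a \<noteq> \<zero>" "b \<in> carrier K" "b \<noteq> \<zero>"
  shows "inv (a \<otimes> b) = inv a \<otimes> inv b"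
  using assms by (intro comm_inv_char) (auto simp: m_ac)

lemma V_carrier: "x \<in> V \<Longrightarrow> x \<in> carrier K"
  using V_subset by auto

lemma V_zero: "\<zero> \<in> V"
  using V_add[OF V_one V_uminus[OF V_one]] by (simp add: r_neg)

lemma t_carrier [simp]: "t \<in> carrier K" and inv_t_carrier [simp]: "inv t \<in> carrier K"
  using t_in_V t_nonzero V_subset by auto

lemma M_carrier: "x \<in> M \<Longrightarrow> x \<in> carrier K"
  by (simp add: M_def)

lemma zero_in_M: "\<zero> \<in> M"
  using V_zero by (simp add: M_def)

lemma M_subset_V: "x \<in> M \<Longrightarrow> x \<in> V"
  using V_mult[OF t_in_V, of "inv t \<otimes> x"] t_nonzero by (auto simp: M_def)

lemma M_iff: "x \<in> M \<longleftrightarrow> x \<in> V \<and> (x = \<zero> \<or> inv x \<notin> V)"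
proof
  assume x: "x \<in> M"
  have "inv x \<notin> V" if "x \<noteq> \<zero>"
  proof
    assume "inv x \<in> V"
    then have "inv t \<otimes> x \<otimes> inv x \<in> V"
      using x by (intro V_mult[of "inv t \<otimes> x"]) (auto simp: M_def)
    moreover have "inv t \<otimes> x \<otimes> inv x = inv t"
      using that M_carrier[OF x] by (simp add: m_assoc)
    ultimately show False
      using inv_t_notin_V by simp
  qed
  then show "x \<in> V \<and> (x = \<zero> \<or> inv x \<notin> V)"
    using M_subset_V[OF x] by blast
next
  assume "x \<in> V \<and> (x = \<zero> \<or> inv x \<notin> V)"
  then show "x \<in> M"
    using nonunit_div_t[of x] zero_in_M V_carrier by (cases "x = \<zero>") (auto simp: M_def)
qed

lemma notin_M: "x \<in> carrier K \<Longrightarrow> x \<notin> M \<Longrightarrow> x \<noteq> \<zero> \<and> inv x \<in> V"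
  using V_valuation zero_in_M by (auto simp: M_iff)

lemma one_notin_M: "\<one> \<notin> M"
  using inv_t_notin_V by (simp add: M_def)

lemma M_mult: "x \<in> M \<Longrightarrow> y \<in> V \<Longrightarrow> x \<otimes> y \<in> M"
  using V_mult[of "inv t \<otimes> x" y] V_carrier by (simp add: M_def m_assoc)

lemma t_mult_V: "x \<in> V \<Longrightarrow> t \<otimes> x \<in> M"
  using V_carrier t_nonzero by (simp add: M_def)

lemma M_add: "x \<in> M \<Longrightarrow> y \<in> M \<Longrightarrow> x \<oplus> y \<in> M"
  using V_add[of "inv t \<otimes> x" "inv t \<otimes> y"] by (simp add: M_def r_distr)

lemma M_uminus: "x \<in> M \<Longrightarrow> \<ominus> x \<in> M"
  using V_uminus[of "inv t \<otimes> x"] by (simp add: M_def r_minus)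

end

text \<open>The set \<open>U\<close> abstracts the set of elements with angular component \<open>1\<close>, for an angular component
  map that sends \<open>t\<close> to \<open>1\<close>.\<close>

locale uniformized_field_ac = uniformized_field +
  fixes U :: "'a set"
  assumes U_subset: "U \<subseteq> carrier K"
    and U_mult_t: "x \<in> carrier K \<Longrightarrow> x \<noteq> \<zero> \<Longrightarrow> t \<otimes> x \<in> U \<longleftrightarrow> x \<in> U"
    and U_unit: "x \<in> V \<Longrightarrow> x \<noteq> \<zero> \<Longrightarrow> inv x \<in> V \<Longrightarrow> x \<in> U \<longleftrightarrow> x \<ominus> \<one> \<in> M"
begin

text \<open>The units of \<open>V\<close> in \<open>U\<close> form the set \<open>1 + M\<close>.\<close>

lemma one_plus_M: "{x \<in> U. x \<in> V \<and> x \<notin> M} = (\<lambda>m. \<one> \<oplus> m) ` M"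
proof (intro equalityI subsetI)
  fix x assume x: "x \<in> {x \<in> U. x \<in> V \<and> x \<notin> M}"
  then have "x \<ominus> \<one> \<in> M"
    using notin_M[of x] U_unit[of x] V_carrier by auto
  moreover have "x = \<one> \<oplus> (x \<ominus> \<one>)"
    using x V_carrier[of x] by (simp add: minus_eq a_lcomm r_neg)
  ultimately show "x \<in> (\<lambda>m. \<one> \<oplus> m) ` M" by blast
next
  fix x assume "x \<in> (\<lambda>m. \<one> \<oplus> m) ` M"
  then obtain m where m: "m \<in> M" "x = \<one> \<oplus> m" by blast
  have mc: "m \<in> carrier K" using m M_carrier by simp
  have xm: "x \<ominus> \<one> = m"
    using mc by (simp add: m(2) minus_eq a_ac r_neg)
  have V: "x \<in> V"
    using m M_subset_V V_add V_one by simp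
  have "x \<notin> M"
  proof
    assume "x \<in> M"
    then have "x \<oplus> \<ominus> m \<in> M"
      using m by (intro M_add M_uminus)
    moreover have "x \<oplus> \<ominus> m = \<one>"
      using mc by (simp add: m(2) a_assoc r_neg)
    ultimately show False using one_notin_M by simp
  qed
  with V show "x \<in> {x \<in> U. x \<in> V \<and> x \<notin> M}"
    using U_unit[of x] notin_M[of x] V_carrier m(1) xm by auto
qed

text \<open>A subset of the plane that is in bijection with its union with the origin. With \<open>Q = U - M\<close> and
  \<open>B = M - {0}\<close>, it is the disjoint union of \<open>Q \<times> B\<close>, \<open>Q \<times> {0}\<close> and \<open>B \<times> B\<close>.\<close>

definition Z :: "('a \<times> 'a) set" where
  "Z = (U - M) \<times> M \<union> (M - {\<zero>}) \<times> (M - {\<zero>})"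

text \<open>The bijection. Division by \<open>t\<close> on \<open>Q \<times> {0}\<close> makes room for \<open>(1 + M) \<times> {0}\<close>, which receives the
  origin and \<open>{1} \<times> B\<close>. The rest of \<open>(1 + M) \<times> B\<close> goes to the pairs in \<open>B \<times> B\<close> with quotient
  \<open>y / x \<in> V\<close>, the set \<open>B \<times> B\<close> goes to the other pairs in \<open>B \<times> B\<close>, and the part of \<open>Q \<times> B\<close> with
  \<open>x \<notin> V\<close> is spread over \<open>Q \<times> B\<close> by multiplication with \<open>t\<close>.\<close>

definition shift :: "'a \<times> 'a \<Rightarrow> 'a \<times> 'a" where
  "shift = (\<lambda>(x, y).
     if y = \<zero> then if x = \<zero> then (\<one>, \<zero>) else (inv t \<otimes> x, \<zero>)
     else if x \<in> M then (x \<otimes> y, y)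
     else if x \<notin> V then (t \<otimes> x, y)
     else if x = \<one> then (\<one> \<oplus> y, \<zero>)
     else (y, y \<otimes> (inv t \<otimes> (x \<ominus> \<one>))))"

lemma bij_shift: "bij_betw shift (insert (\<zero>, \<zero>) Z) Z"
proof -
  let ?B = "M - {\<zero>}"
  let ?O = "{x \<in> U. x \<in> V \<and> x \<notin> M}"
  let ?D1 = "(U - V) \<times> ?B" and ?R1 = "(U - M) \<times> ?B"
  let ?D2 = "(?O - {\<one>}) \<times> ?B" and ?R2 = "{(x, y). x \<in> ?B \<and> y \<in> ?B \<and> inv x \<otimes> y \<in> V}"
  let ?D3 = "{\<one>} \<times> ?B \<union> {(\<zero>, \<zero>)}" and ?R3 = "?O \<times> {\<zero>}"
  let ?D4 = "?B \<times> ?B" and ?R4 = "{(x, y). x \<in> ?B \<and> y \<in> ?B \<and> inv x \<otimes> y \<notin> V}"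
  let ?D5 = "(U - M) \<times> {\<zero>}" and ?R5 = "(U - V) \<times> {\<zero>}"
  have U: "x \<in> carrier K" if "x \<in> U" for x
    using that U_subset by auto
  have B: "x \<in> carrier K" "x \<noteq> \<zero>" "x \<in> V" if "x \<in> ?B" for x
    using that M_carrier M_subset_V by auto
  have nz: "x \<noteq> \<zero>" if "x \<notin> M" for x
    using that zero_in_M by auto
  have nzV: "x \<noteq> \<zero>" if "x \<notin> V" for x
    using that V_zero by auto
  have div_t: "inv t \<otimes> x \<in> U - V" if "x \<in> U - M" for x
  proof -
    have "inv t \<otimes> x \<noteq> \<zero>"
      using that nz[of x] t_nonzero U by (simp add: integral_iff)
    then have "inv t \<otimes> x \<in> U"
      using that U_mult_t[of "inv t \<otimes> x"] U t_nonzero by simp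
    then show ?thesis
      using that U by (auto simp: M_def)
  qed
  have mult_t: "t \<otimes> x \<in> U - M" if "x \<in> U - V" for x
    using that U U_mult_t[of x] nzV[of x] t_nonzero by (auto simp: M_def)
  have "bij_betw shift ?D1 ?R1"
  proof (subst bij_betw_cong)
    show "shift a = (\<lambda>(x, y). (t \<otimes> x, y)) a" if a: "a \<in> ?D1" for a
    proof -
      obtain x y where "a = (x, y)" "x \<notin> V" "y \<noteq> \<zero>"
        using a by auto
      then show ?thesis
        using M_subset_V by (auto simp: shift_def)
    qed
    show "bij_betw (\<lambda>(x, y). (t \<otimes> x, y)) ?D1 ?R1"
      by (rule bij_betw_byWitness[where f' = "\<lambda>(x, y). (inv t \<otimes> x, y)"])
        (use div_t mult_t t_nonzero U in auto)
  qed
  moreover have "bij_betw shift ?D2 ?R2"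
  proof (subst bij_betw_cong)
    show "shift a = (\<lambda>(x, y). (y, y \<otimes> (inv t \<otimes> (x \<ominus> \<one>)))) a" if a: "a \<in> ?D2" for a
    proof -
      obtain x y where "a = (x, y)" "x \<in> V" "x \<notin> M" "x \<noteq> \<one>" "y \<noteq> \<zero>"
        using a by auto
      then show ?thesis
        by (auto simp: shift_def)
    qed
    have x: "x \<ominus> \<one> \<noteq> \<zero>" "inv t \<otimes> (x \<ominus> \<one>) \<in> V" "inv t \<otimes> (x \<ominus> \<one>) \<noteq> \<zero>" "x \<in> carrier K"
      if "x \<in> ?O" "x \<noteq> \<one>" for x
    proof -
      show x: "x \<in> carrier K" using that U by blast
      show 1: "x \<ominus> \<one> \<noteq> \<zero>"
        using that x by simp
      show "inv t \<otimes> (x \<ominus> \<one>) \<in> V"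
        using that U_unit[of x] notin_M[of x] x by (simp add: M_def)
      show "inv t \<otimes> (x \<ominus> \<one>) \<noteq> \<zero>"
        using 1 x t_nonzero by (simp add: integral_iff)
    qed
    have s: "\<one> \<oplus> t \<otimes> (inv x \<otimes> y) \<in> ?O" "\<one> \<oplus> t \<otimes> (inv x \<otimes> y) \<noteq> \<one>"
      "(\<one> \<oplus> t \<otimes> (inv x \<otimes> y)) \<ominus> \<one> = t \<otimes> (inv x \<otimes> y)"
      if "x \<in> ?B" "y \<in> ?B" "inv x \<otimes> y \<in> V" for x y
    proof -
      have c: "x \<in> carrier K" "x \<noteq> \<zero>" "y \<in> carrier K" "y \<noteq> \<zero>" using that B by auto
      show "\<one> \<oplus> t \<otimes> (inv x \<otimes> y) \<in> ?O"
        unfolding one_plus_M using t_mult_V[OF that(3)] by blast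
      show eq: "(\<one> \<oplus> t \<otimes> (inv x \<otimes> y)) \<ominus> \<one> = t \<otimes> (inv x \<otimes> y)"
        using c by (simp add: minus_eq a_ac r_neg2)
      have "t \<otimes> (inv x \<otimes> y) \<noteq> \<zero>"
        using c t_nonzero by (simp add: integral_iff)
      then show "\<one> \<oplus> t \<otimes> (inv x \<otimes> y) \<noteq> \<one>"
        using eq by (auto simp: minus_eq r_neg)
    qed
    have x': "y \<otimes> (inv t \<otimes> (x \<ominus> \<one>)) \<in> ?B" "inv y \<otimes> (y \<otimes> (inv t \<otimes> (x \<ominus> \<one>))) \<in> V"
      "\<one> \<oplus> t \<otimes> (inv y \<otimes> (y \<otimes> (inv t \<otimes> (x \<ominus> \<one>)))) = x"
      if "x \<in> ?O" "x \<noteq> \<one>" "y \<in> ?B" for x y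
    proof -
      have c: "y \<in> carrier K" "y \<noteq> \<zero>" using that(3) B by auto
      show "y \<otimes> (inv t \<otimes> (x \<ominus> \<one>)) \<in> ?B"
        using M_mult[of y "inv t \<otimes> (x \<ominus> \<one>)"] x[OF that(1,2)] that(3) c by (simp add: integral_iff)
      show "inv y \<otimes> (y \<otimes> (inv t \<otimes> (x \<ominus> \<one>))) \<in> V"
        using x[OF that(1,2)] c by simp
      show "\<one> \<oplus> t \<otimes> (inv y \<otimes> (y \<otimes> (inv t \<otimes> (x \<ominus> \<one>)))) = x"
        using x[OF that(1,2)] c t_nonzero by (simp add: minus_eq a_lcomm r_neg)
    qed
    have s': "x \<otimes> (inv t \<otimes> ((\<one> \<oplus> t \<otimes> (inv x \<otimes> y)) \<ominus> \<one>)) = y"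
      if "x \<in> ?B" "y \<in> ?B" "inv x \<otimes> y \<in> V" for x y
      unfolding s(3)[OF that] using that(1,2)[THEN B(1)] that(1,2)[THEN B(2)] t_nonzero by simp
    show "bij_betw (\<lambda>(x, y). (y, y \<otimes> (inv t \<otimes> (x \<ominus> \<one>)))) ?D2 ?R2"
    proof (rule bij_betw_byWitness[where f' = "\<lambda>(x, y). (\<one> \<oplus> t \<otimes> (inv x \<otimes> y), x)"])
      show "\<forall>a\<in>?D2. (\<lambda>(x, y). (\<one> \<oplus> t \<otimes> (inv x \<otimes> y), x))
          ((\<lambda>(x, y). (y, y \<otimes> (inv t \<otimes> (x \<ominus> \<one>)))) a) = a"
      proof
        fix a assume "a \<in> ?D2"
        then obtain x y where xy: "a = (x, y)" "x \<in> ?O" "x \<noteq> \<one>" "y \<in> ?B" by blast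
        show "(\<lambda>(x, y). (\<one> \<oplus> t \<otimes> (inv x \<otimes> y), x))
          ((\<lambda>(x, y). (y, y \<otimes> (inv t \<otimes> (x \<ominus> \<one>)))) a) = a"
          unfolding xy(1) prod.case x'(3)[OF xy(2-4)] ..
      qed
      show "\<forall>a\<in>?R2. (\<lambda>(x, y). (y, y \<otimes> (inv t \<otimes> (x \<ominus> \<one>))))
          ((\<lambda>(x, y). (\<one> \<oplus> t \<otimes> (inv x \<otimes> y), x)) a) = a"
      proof
        fix a assume "a \<in> ?R2"
        then obtain x y where xy: "a = (x, y)" "x \<in> ?B" "y \<in> ?B" "inv x \<otimes> y \<in> V"
          by (cases a) simp
        show "(\<lambda>(x, y). (y, y \<otimes> (inv t \<otimes> (x \<ominus> \<one>))))
          ((\<lambda>(x, y). (\<one> \<oplus> t \<otimes> (inv x \<otimes> y), x)) a) = a"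
          unfolding xy(1) prod.case s'[OF xy(2-4)] ..
      qed
      show "(\<lambda>(x, y). (y, y \<otimes> (inv t \<otimes> (x \<ominus> \<one>)))) ` ?D2 \<subseteq> ?R2"
      proof (rule image_subsetI)
        fix a assume "a \<in> ?D2"
        then obtain x y where xy: "a = (x, y)" "x \<in> ?O" "x \<noteq> \<one>" "y \<in> ?B" by blast
        show "(\<lambda>(x, y). (y, y \<otimes> (inv t \<otimes> (x \<ominus> \<one>)))) a \<in> ?R2"
          unfolding xy(1) prod.case mem_Collect_eq using xy(4) x'(1,2)[OF xy(2-4)] by (intro conjI)
      qed
      show "(\<lambda>(x, y). (\<one> \<oplus> t \<otimes> (inv x \<otimes> y), x)) ` ?R2 \<subseteq> ?D2"
      proof (rule image_subsetI)
        fix a assume "a \<in> ?R2"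
        then obtain x y where xy: "a = (x, y)" "x \<in> ?B" "y \<in> ?B" "inv x \<otimes> y \<in> V"
          by (cases a) simp
        show "(\<lambda>(x, y). (\<one> \<oplus> t \<otimes> (inv x \<otimes> y), x)) a \<in> ?D2"
          unfolding xy(1) prod.case using s(1,2)[OF xy(2-4)] xy(2) by (intro SigmaI DiffI) simp_all
      qed
    qed
  qed
  moreover have "bij_betw shift ?D3 ?R3"
  proof (subst bij_betw_cong)
    show "shift a = (\<lambda>(x, y). (\<one> \<oplus> y, \<zero>)) a" if a: "a \<in> ?D3" for a
    proof -
      obtain x y where "a = (x, y)" "x = \<one> \<and> y \<noteq> \<zero> \<or> x = \<zero> \<and> y = \<zero>"
        using a by auto
      then show ?thesis
        using one_notin_M V_one by (auto simp: shift_def)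
    qed
    have "bij_betw (\<lambda>m. (\<one> \<oplus> m, \<zero>)) M ?R3"
      unfolding one_plus_M using M_carrier by (auto simp: bij_betw_def inj_on_def)
    moreover have "bij_betw snd ?D3 M"
      using zero_in_M by (auto simp: bij_betw_def inj_on_def image_iff)
    ultimately have "bij_betw ((\<lambda>m. (\<one> \<oplus> m, \<zero>)) \<circ> snd) ?D3 ?R3"
      by (intro bij_betw_trans)
    then show "bij_betw (\<lambda>(x, y). (\<one> \<oplus> y, \<zero>)) ?D3 ?R3"
      by (simp add: comp_def case_prod_unfold)
  qed
  moreover have "bij_betw shift ?D4 ?R4"
  proof (subst bij_betw_cong)
    show "shift a = (\<lambda>(x, y). (x \<otimes> y, y)) a" if a: "a \<in> ?D4" for a
    proof -
      obtain x y where "a = (x, y)" "x \<in> M" "y \<noteq> \<zero>"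
        using a by auto
      then show ?thesis
        by (auto simp: shift_def)
    qed
    have 1: "inv (x \<otimes> y) \<otimes> y \<notin> V" if "x \<in> ?B" "y \<in> ?B" for x y
    proof -
      have c: "x \<in> carrier K" "x \<noteq> \<zero>" "y \<in> carrier K" "y \<noteq> \<zero>" using that B by auto
      then have "inv (x \<otimes> y) \<otimes> y = inv x"
        by (simp add: inv_mult m_assoc)
      then show ?thesis
        using that(1) by (auto simp: M_iff)
    qed
    have 2: "x \<otimes> inv y \<in> ?B" if "x \<in> ?B" "y \<in> ?B" "inv x \<otimes> y \<notin> V" for x y
    proof -
      have c: "x \<in> carrier K" "x \<noteq> \<zero>" "y \<in> carrier K" "y \<noteq> \<zero>" using that B by auto
      then have "inv (x \<otimes> inv y) = inv x \<otimes> y" "x \<otimes> inv y \<noteq> \<zero>"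
        by (simp_all add: inv_mult integral_iff)
      then show ?thesis
        using V_valuation[of "x \<otimes> inv y"] that c by (auto simp: M_iff)
    qed
    have 3: "x \<otimes> y \<in> ?B" if "x \<in> ?B" "y \<in> ?B" for x y
      using M_mult[of x y] B[OF that(1)] B[OF that(2)] that by (simp add: integral_iff)
    have 4: "x \<otimes> y \<otimes> inv y = x" "x \<otimes> inv y \<otimes> y = x" if "x \<in> ?B" "y \<in> ?B" for x y
      using B(1,2)[OF that(1)] B(1,2)[OF that(2)] by (simp_all add: m_assoc)
    show "bij_betw (\<lambda>(x, y). (x \<otimes> y, y)) ?D4 ?R4"
    proof (rule bij_betw_byWitness[where f' = "\<lambda>(x, y). (x \<otimes> inv y, y)"])
      show "(\<lambda>(x, y). (x \<otimes> y, y)) ` ?D4 \<subseteq> ?R4"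
      proof (rule image_subsetI)
        fix a assume "a \<in> ?D4"
        then obtain x y where xy: "a = (x, y)" "x \<in> ?B" "y \<in> ?B" by blast
        show "(\<lambda>(x, y). (x \<otimes> y, y)) a \<in> ?R4"
          unfolding xy(1) prod.case mem_Collect_eq using xy(3) 1[OF xy(2,3)] 3[OF xy(2,3)] by (intro conjI)
      qed
      show "(\<lambda>(x, y). (x \<otimes> inv y, y)) ` ?R4 \<subseteq> ?D4"
      proof (rule image_subsetI)
        fix a assume "a \<in> ?R4"
        then obtain x y where xy: "a = (x, y)" "x \<in> ?B" "y \<in> ?B" "inv x \<otimes> y \<notin> V"
          by (cases a) simp
        show "(\<lambda>(x, y). (x \<otimes> inv y, y)) a \<in> ?D4"
          unfolding xy(1) prod.case using 2[OF xy(2-4)] xy(3) by (rule SigmaI)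
      qed
    qed (use 4 in auto)
  qed
  moreover have "bij_betw shift ?D5 ?R5"
  proof (subst bij_betw_cong)
    show "shift a = (\<lambda>(x, y). (inv t \<otimes> x, y)) a" if a: "a \<in> ?D5" for a
    proof -
      obtain x where "a = (x, \<zero>)" "x \<noteq> \<zero>"
        using a nz by auto
      then show ?thesis
        by (auto simp: shift_def)
    qed
    show "bij_betw (\<lambda>(x, y). (inv t \<otimes> x, y)) ?D5 ?R5"
      by (rule bij_betw_byWitness[where f' = "\<lambda>(x, y). (t \<otimes> x, y)"])
        (use div_t mult_t t_nonzero U in auto)
  qed
  ultimately have "bij_betw shift ((((?D1 \<union> ?D2) \<union> ?D3) \<union> ?D4) \<union> ?D5) ((((?R1 \<union> ?R2) \<union> ?R3) \<union> ?R4) \<union> ?R5)"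
    by (intro bij_betw_combine) auto
  moreover have "\<one> \<in> ?O"
    unfolding one_plus_M using zero_in_M by force
  then have "((((?D1 \<union> ?D2) \<union> ?D3) \<union> ?D4) \<union> ?D5) = insert (\<zero>, \<zero>) Z"
    using M_subset_V zero_in_M unfolding Z_def by blast
  moreover have "((((?R1 \<union> ?R2) \<union> ?R3) \<union> ?R4) \<union> ?R5) = Z"
    using M_subset_V zero_in_M unfolding Z_def by blast
  ultimately show ?thesis by simp
qed

lemma Z_subset: "Z \<subseteq> carrier K \<times> carrier K" and zero_notin_Z: "(\<zero>, \<zero>) \<notin> Z"
  using U_subset M_carrier zero_in_M by (auto simp: Z_def)

text \<open>The graph of \<^const>\<open>shift\<close> on \<open>Z\<close> and the origin, described without division so that it
  can be read as a formula.\<close>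

definition shift_rel :: "'a \<Rightarrow> 'a \<Rightarrow> 'a \<Rightarrow> 'a \<Rightarrow> bool" where
  "shift_rel x y x' y' \<longleftrightarrow>
     (x \<in> U \<and> x \<notin> V \<and> y \<in> M \<and> y \<noteq> \<zero> \<and> x' = t \<otimes> x \<and> y' = y) \<or>
     (x \<in> U \<and> x \<in> V \<and> x \<notin> M \<and> x \<noteq> \<one> \<and> y \<in> M \<and> y \<noteq> \<zero> \<and> x' = y \<and> t \<otimes> y' = y \<otimes> (x \<oplus> \<ominus> \<one>)) \<or>
     (x = \<one> \<and> y \<in> M \<and> y \<noteq> \<zero> \<and> x' = \<one> \<oplus> y \<and> y' = \<zero>) \<or>
     (x = \<zero> \<and> y = \<zero> \<and> x' = \<one> \<and> y' = \<zero>) \<or>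
     (x \<in> M \<and> x \<noteq> \<zero> \<and> y \<in> M \<and> y \<noteq> \<zero> \<and> x' = x \<otimes> y \<and> y' = y) \<or>
     (x \<in> U \<and> x \<notin> M \<and> y = \<zero> \<and> t \<otimes> x' = x \<and> y' = \<zero>)"

lemma shift_rel_iff:
  assumes c: "x \<in> carrier K" "y \<in> carrier K" "x' \<in> carrier K" "y' \<in> carrier K"
  shows "shift_rel x y x' y' \<longleftrightarrow> (x, y) \<in> insert (\<zero>, \<zero>) Z \<and> (x', y') = shift (x, y)"
proof -
  have div: "t \<otimes> a = b \<longleftrightarrow> a = inv t \<otimes> b" if "a \<in> carrier K" "b \<in> carrier K" for a b
    using that t_nonzero by auto
  have "y \<otimes> (inv t \<otimes> (x \<ominus> \<one>)) = inv t \<otimes> (y \<otimes> (x \<oplus> \<ominus> \<one>))"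
    using c by (simp add: minus_eq m_lcomm)
  moreover have "\<one> \<in> U"
    using one_plus_M zero_in_M by force
  ultimately show ?thesis
    using c M_subset_V zero_in_M V_one V_zero one_notin_M
    unfolding shift_rel_def Z_def shift_def
    by (auto simp: div)
qed

end

text \<open>In prime characteristic \<open>p\<close> the plane embeds into the line by \<open>(x, y) \<mapsto> x\<^sup>p + t y\<^sup>p\<close>, because \<open>t\<close> is
  not a quotient of \<open>p\<close>-th powers.\<close>

locale uniformized_field_char = uniformized_field_ac +
  fixes p :: nat
  assumes prime_p: "prime p" and char_p: "[p] \<cdot> \<one> = \<zero>"
begin

definition embed :: "'a \<times> 'a \<Rightarrow> 'a" where
  "embed = (\<lambda>(x, y). x [^] p \<oplus> t \<otimes> y [^] p)"

lemma not_power_t: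
  assumes "a \<in> carrier K" "b \<in> carrier K" "a [^] p = t \<otimes> b [^] p"
  shows "b = \<zero>"
proof (rule ccontr)
  assume b: "b \<noteq> \<zero>"
  define u where "u = a \<otimes> inv b"
  have uc: "u \<in> carrier K"
    using assms b by (simp add: u_def)
  have "b [^] p \<otimes> inv b [^] p = \<one>"
    using assms b by (simp flip: nat_pow_distrib)
  then have u: "u [^] p = t"
    using assms b by (simp add: u_def nat_pow_distrib m_assoc)
  have "p \<noteq> 0" using prime_p by auto
  then have u0: "u \<noteq> \<zero>"
    using u t_nonzero by (auto simp: nat_pow_zero)
  have pow_V: "v [^] n \<in> V" if "v \<in> V" for v and n :: nat
    using that by (induction n) (auto simp: V_one V_mult)
  have "inv u [^] p \<otimes> t = \<one>"
    using uc u0 unfolding u[symmetric] by (simp flip: nat_pow_distrib)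
  then have "inv u [^] p = inv t"
    using uc u0 by (intro comm_inv_char[symmetric]) (auto simp: m_comm)
  then have "inv u \<notin> V"
    using pow_V inv_t_notin_V by metis
  then have "u \<in> V" using V_valuation uc u0 by blast
  then have "u \<in> M"
    using \<open>inv u \<notin> V\<close> by (simp add: M_iff)
  have "p = Suc (Suc (p - 2))"
    using prime_ge_2_nat[OF prime_p] by simp
  then have "u [^] p = u \<otimes> (u \<otimes> u [^] (p - 2))"
    using uc by (metis nat_pow_Suc2 nat_pow_closed)
  then have tu: "t = u \<otimes> (u \<otimes> u [^] (p - 2))"
    by (simp add: u)
  have "inv t \<otimes> t = inv t \<otimes> (u \<otimes> (u \<otimes> u [^] (p - 2)))"
    by (rule arg_cong[OF tu])
  also have "\<dots> = (inv t \<otimes> u) \<otimes> (u \<otimes> u [^] (p - 2))"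
    using uc by (simp add: m_assoc)
  also have "\<dots> \<in> M"
  proof -
    have "u \<otimes> u [^] (p - 2) \<in> M"
      using \<open>u \<in> M\<close> \<open>u \<in> V\<close> by (intro M_mult pow_V)
    then show ?thesis
      using M_mult[of "u \<otimes> u [^] (p - 2)" "inv t \<otimes> u"] \<open>u \<in> M\<close> uc by (simp add: M_def m_comm)
  qed
  finally show False
    using one_notin_M t_nonzero by simp
qed

lemma inj_embed: "inj_on embed (carrier K \<times> carrier K)"
proof (rule inj_onI)
  have minus: "(a \<ominus> b) [^] p = a [^] p \<ominus> b [^] p" if "a \<in> carrier K" "b \<in> carrier K" for a b
  proof -
    have "a [^] p = (a \<ominus> b) [^] p \<oplus> b [^] p"
      using that freshmans_dream_char[OF prime_p char_p, of "a \<ominus> b" b] by (simp add: minus_eq a_assoc l_neg)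
    then show ?thesis
      using that by (simp add: minus_eq a_assoc r_neg)
  qed
  have p0: "p \<noteq> 0" using prime_p by auto
  have pow0: "a = \<zero>" if "a \<in> carrier K" "a [^] (n::nat) = \<zero>" for a n
    using that by (induction n) (auto simp: integral_iff)
  fix a b assume "a \<in> carrier K \<times> carrier K" "b \<in> carrier K \<times> carrier K" "embed a = embed b"
  then obtain x y x' y' where c [simp]: "x \<in> carrier K" "y \<in> carrier K" "x' \<in> carrier K" "y' \<in> carrier K"
    and ab: "a = (x, y)" "b = (x', y')" and eq: "x [^] p \<oplus> t \<otimes> y [^] p = x' [^] p \<oplus> t \<otimes> y' [^] p"
    by (auto simp: embed_def)
  have "x [^] p \<ominus> x' [^] p = (x [^] p \<oplus> t \<otimes> y [^] p) \<ominus> t \<otimes> y [^] p \<ominus> x' [^] p"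
    by (simp add: minus_eq a_assoc r_neg)
  also have "\<dots> = t \<otimes> (y' [^] p \<ominus> y [^] p)"
    unfolding eq by (simp add: minus_eq a_ac r_neg r_distr r_minus r_neg1 r_neg2)
  finally have *: "(x \<ominus> x') [^] p = t \<otimes> (y' \<ominus> y) [^] p"
    by (simp add: minus)
  then have y: "y' \<ominus> y = \<zero>"
    by (intro not_power_t[of "x \<ominus> x'"]) auto
  with * p0 have "(x \<ominus> x') [^] p = \<zero>"
    by (simp add: nat_pow_zero)
  then have "x \<ominus> x' = \<zero>"
    using pow0[of "x \<ominus> x'" p] by simp
  with y show "a = b"
    by (simp add: ab)
qed

lemma embed_zero: "embed (\<zero>, \<zero>) = \<zero>"
  using prime_p by (auto simp: embed_def nat_pow_zero prime_gt_0_nat)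

lemma embed_closed: "a \<in> carrier K \<times> carrier K \<Longrightarrow> embed a \<in> carrier K"
  by (auto simp: embed_def)

text \<open>The map \<^const>\<open>shift\<close> transported to the line, extended by the identity.\<close>

definition puncture :: "'a \<Rightarrow> 'a" where
  "puncture z = (if z \<in> embed ` insert (\<zero>, \<zero>) Z
     then embed (shift (the_inv_into (insert (\<zero>, \<zero>) Z) embed z)) else z)"

lemma Z0_subset: "insert (\<zero>, \<zero>) Z \<subseteq> carrier K \<times> carrier K"
  using Z_subset by auto

lemma puncture_embed:
  assumes "a \<in> insert (\<zero>, \<zero>) Z"
  shows "puncture (embed a) = embed (shift a)"
  unfolding puncture_def if_P[OF imageI[OF assms]]
  using the_inv_into_f_f[OF inj_on_subset[OF inj_embed Z0_subset] assms] by simp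

lemma bij_puncture: "bij_betw puncture (carrier K) (carrier K - {\<zero>})"
proof -
  let ?Z = "insert (\<zero>, \<zero>) Z"
  have embed: "bij_betw embed A (embed ` A)" if "A \<subseteq> ?Z" for A
    using inj_on_subset[OF inj_embed order.trans[OF that Z0_subset]] by (rule inj_on_imp_bij_betw)
  have "bij_betw puncture (embed ` ?Z) (embed ` Z)"
  proof (subst bij_betw_cong)
    show "puncture z = (embed \<circ> (shift \<circ> the_inv_into ?Z embed)) z" if "z \<in> embed ` ?Z" for z
      using that by (simp add: puncture_def)
    have "bij_betw (the_inv_into ?Z embed) (embed ` ?Z) ?Z"
      by (rule bij_betw_the_inv_into[OF embed[OF order.refl]])
    then have "bij_betw (shift \<circ> the_inv_into ?Z embed) (embed ` ?Z) Z"
      using bij_shift by (rule bij_betw_trans)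
    then show "bij_betw (embed \<circ> (shift \<circ> the_inv_into ?Z embed)) (embed ` ?Z) (embed ` Z)"
      using embed[OF subset_insertI] by (rule bij_betw_trans)
  qed
  moreover have "bij_betw puncture (carrier K - embed ` ?Z) (carrier K - embed ` ?Z)"
    by (subst bij_betw_cong[of _ _ id]) (auto simp: puncture_def)
  ultimately have "bij_betw puncture (embed ` ?Z \<union> (carrier K - embed ` ?Z))
      (embed ` Z \<union> (carrier K - embed ` ?Z))"
    by (rule bij_betw_combine) auto
  moreover have "embed ` ?Z \<union> (carrier K - embed ` ?Z) = carrier K"
    using embed_closed Z0_subset by blast
  moreover have "embed ` Z \<union> (carrier K - embed ` ?Z) = carrier K - {\<zero>}"
  proof -
    have "\<zero> \<notin> embed ` Z"
    proof
      assume "\<zero> \<in> embed ` Z"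
      then obtain a where "a \<in> Z" "embed a = embed (\<zero>, \<zero>)"
        by (metis embed_zero imageE)
      then show False
        using inj_onD[OF inj_embed] Z0_subset zero_notin_Z by blast
    qed
    then show ?thesis
      using embed_closed Z0_subset embed_zero by auto
  qed
  ultimately show ?thesis by simp
qed

text \<open>The image of the embedding and the values of \<^const>\<open>puncture\<close> are expressed through
  \<^const>\<open>shift_rel\<close> only.\<close>

lemma graph_puncture:
  assumes "z \<in> carrier K" "w \<in> carrier K"
  shows "w = puncture z \<longleftrightarrow>
    (\<exists>x\<in>carrier K. \<exists>y\<in>carrier K. \<exists>x'\<in>carrier K. \<exists>y'\<in>carrier K.
      z = embed (x, y) \<and> shift_rel x y x' y' \<and> w = embed (x', y')) \<or>
    \<not> (\<exists>x\<in>carrier K. \<exists>y\<in>carrier K. \<exists>x'\<in>carrier K. \<exists>y'\<in>carrier K.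
      z = embed (x, y) \<and> shift_rel x y x' y') \<and> w = z"
proof -
  let ?Z = "insert (\<zero>, \<zero>) Z"
  have 1: "(\<exists>x\<in>carrier K. \<exists>y\<in>carrier K. \<exists>x'\<in>carrier K. \<exists>y'\<in>carrier K.
      z = embed (x, y) \<and> shift_rel x y x' y' \<and> Q x' y') \<longleftrightarrow>
    (\<exists>a\<in>?Z. z = embed a \<and> case_prod Q (shift a))" for Q
  proof
    assume "\<exists>a\<in>?Z. z = embed a \<and> case_prod Q (shift a)"
    then obtain a where a: "a \<in> ?Z" "z = embed a" "case_prod Q (shift a)" by (elim bexE conjE)
    obtain x y where xy1: "a = (x, y)" by (cases a)
    obtain x' y' where xy2: "shift a = (x', y')" by (cases "shift a")
    note xy = xy1 xy2
    have c: "x \<in> carrier K" "y \<in> carrier K"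
      using a(1) Z0_subset xy by auto
    have "(x', y') \<in> Z"
      using bij_betw_apply[OF bij_shift a(1)] xy by simp
    then have c': "x' \<in> carrier K" "y' \<in> carrier K"
      using Z_subset by auto
    have "shift_rel x y x' y'"
      using shift_rel_iff[OF c c'] a xy by simp
    with a c c' xy show "\<exists>x\<in>carrier K. \<exists>y\<in>carrier K. \<exists>x'\<in>carrier K. \<exists>y'\<in>carrier K.
      z = embed (x, y) \<and> shift_rel x y x' y' \<and> Q x' y'"
      by auto
  next
    assume "\<exists>x\<in>carrier K. \<exists>y\<in>carrier K. \<exists>x'\<in>carrier K. \<exists>y'\<in>carrier K.
      z = embed (x, y) \<and> shift_rel x y x' y' \<and> Q x' y'"
    then obtain x y x' y' where "x \<in> carrier K" "y \<in> carrier K" "x' \<in> carrier K" "y' \<in> carrier K"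
      "z = embed (x, y)" "shift_rel x y x' y'" "Q x' y'" by blast
    then show "\<exists>a\<in>?Z. z = embed a \<and> case_prod Q (shift a)"
      using shift_rel_iff[of x y x' y'] by (intro bexI[of _ "(x, y)"]) auto
  qed
  have "w = puncture z \<longleftrightarrow> (\<exists>a\<in>?Z. z = embed a \<and> w = embed (shift a)) \<or> \<not> (\<exists>a\<in>?Z. z = embed a) \<and> w = z"
  proof (cases "\<exists>a\<in>?Z. z = embed a")
    case True
    then show ?thesis
      using puncture_embed by metis
  next
    case False
    then have "z \<notin> embed ` ?Z" by blast
    then have "puncture z = z"
      unfolding puncture_def by (rule if_not_P)
    with False show ?thesis by auto
  qed
  then show ?thesis
    using 1[of "\<lambda>x' y'. w = embed (x', y')"] 1[of "\<lambda>_ _. True"]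
    by (simp only: case_prod_unfold simp_thms prod.collapse)
qed

end

section \<open>Valuations with values in lexicographically ordered integer vectors\<close>

text \<open>The nonnegative vectors in the lexicographic order: the first nonzero entry, if any, is
  positive.\<close>

fun lex_nonneg :: "int list \<Rightarrow> bool" where
  "lex_nonneg [] \<longleftrightarrow> True"
| "lex_nonneg (a # r) \<longleftrightarrow> a > 0 \<or> a = 0 \<and> lex_nonneg r"

lemma zvec_le_zero_iff: "length r = k \<Longrightarrow> zvec_le (zvec_zero k) (Some r) \<longleftrightarrow> lex_nonneg r"
proof (induction r arbitrary: k)
  case (Cons a r)
  then show ?case
    by (cases k) (auto simp: zvec_zero_def)
qed (simp add: zvec_zero_def)

lemma lex_nonneg_add:
  "length r = length s \<Longrightarrow> lex_nonneg r \<Longrightarrow> lex_nonneg s \<Longrightarrow> lex_nonneg (map2 (+) r s)"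
  by (induction r s rule: list_induct2) auto

lemma lex_nonneg_uminus: "lex_nonneg r \<or> lex_nonneg (map uminus r)"
  by (induction r) auto

lemma lex_nonneg_antisym: "lex_nonneg r \<Longrightarrow> lex_nonneg (map uminus r) \<Longrightarrow> r = replicate (length r) 0"
  by (induction r) auto

text \<open>The last unit vector is the least positive one.\<close>

lemma lex_nonneg_diff_unit:
  "length r = Suc m \<Longrightarrow> lex_nonneg r \<Longrightarrow> r \<noteq> replicate (Suc m) 0 \<Longrightarrow>
    lex_nonneg (map2 (+) (replicate m 0 @ [- 1]) r)"
proof (induction m arbitrary: r)
  case 0
  then show ?case by (auto simp: length_Suc_conv)
next
  case (Suc m)
  then obtain a r' where r: "r = a # r'" "length r' = Suc m"
    by (auto simp: length_Suc_conv)
  show ?case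
  proof (cases "a > 0")
    case False
    then show ?thesis
      using Suc.IH[of r'] Suc.prems r by auto
  qed (simp add: r)
qed

lemma not_lex_nonneg_uminus_unit: "\<not> lex_nonneg (replicate m 0 @ [- 1])"
  by (induction m) auto

lemma zvec_unit_last: "zvec_unit (Suc m) m = Some (replicate m 0 @ [1])"
  by (auto simp: zvec_unit_def list_eq_iff_nth_eq nth_list_update nth_append less_Suc_eq simp del: replicate_Suc)

lemma map2_add_eq_zero:
  "length r = k \<Longrightarrow> length s = k \<Longrightarrow> map2 (+) r s = replicate k (0::int) \<Longrightarrow> s = map uminus r"
  by (auto simp: list_eq_iff_nth_eq eq_neg_iff_add_eq_0 add.commute)

lemma zvec_le_trans_zero:
  assumes "zvec_le (zvec_zero k) a" "zvec_le a b"
  shows "zvec_le (zvec_zero k) b"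
proof -
  have "trans (lex {(a, b). a < (b::int)})"
    by (rule lex_transI) (auto simp: trans_def)
  then show ?thesis
    using assms by (cases a; cases b) (auto simp: zvec_zero_def dest: transD)
qed

text \<open>A field with a valuation onto \<open>\<int>\<^sup>k\<close>.\<close>

locale lex_valued_field = field K for K (structure) +
  fixes k :: nat and v :: "'a \<Rightarrow> zvec"
  assumes valuation: "valuation_onto K k v"
begin

lemma v_Some:
  assumes "x \<in> carrier K" "x \<noteq> \<zero>"
  obtains r where "v x = Some r" "length r = k"
proof -
  have "v x \<in> zgroup k"
    using valuation assms unfolding valuation_onto_def by blast
  then show ?thesis
    using that by (auto simp: zgroup_def)
qed

lemma v_zero: "v \<zero> = None"
  using valuation by (simp add: valuation_onto_def)

lemma v_mult: "x \<in> carrier K \<Longrightarrow> y \<in> carrier K \<Longrightarrow> v (x \<otimes> y) = zvec_add (v x) (v y)"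
  using valuation by (simp add: valuation_onto_def)

lemma v_one: "v \<one> = zvec_zero k"
proof -
  obtain r where r: "v \<one> = Some r" "length r = k"
    using v_Some[of \<one>] by auto
  then have "r = map2 (+) r r"
    using v_mult[of \<one> \<one>] by simp
  then have "r ! i = r ! i + r ! i" if "i < k" for i
    using that r(2) by (metis length_map length_zip min.idem nth_map nth_zip case_prod_conv)
  then show ?thesis
    using r by (simp add: zvec_zero_def list_eq_iff_nth_eq)
qed

lemma v_inv:
  assumes "x \<in> carrier K" "x \<noteq> \<zero>" "v x = Some r" "length r = k"
  shows "v (inv x) = Some (map uminus r)"
proof -
  have u: "x \<in> Units K" using assms by (simp add: field_Units)
  then have i: "inv x \<in> carrier K" "x \<otimes> inv x = \<one>" by auto
  then have "inv x \<noteq> \<zero>" using assms(1) by auto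
  then obtain s where s: "v (inv x) = Some s" "length s = k"
    using v_Some i by blast
  have "map2 (+) r s = replicate k 0"
    using v_mult[OF assms(1) i(1)] i(2) assms(3) s v_one by (simp add: zvec_zero_def)
  then show ?thesis
    using map2_add_eq_zero assms(4) s by simp
qed

text \<open>The carrier of the valuation ring.\<close>

definition V :: "'a set" where
  "V = {x \<in> carrier K. zvec_le (zvec_zero k) (v x)}"

lemma V_iff: "x \<in> carrier K \<Longrightarrow> v x = Some r \<Longrightarrow> length r = k \<Longrightarrow> x \<in> V \<longleftrightarrow> lex_nonneg r"
  by (simp add: V_def zvec_le_zero_iff)

lemma V_inv:
  assumes "x \<in> carrier K" "x \<noteq> \<zero>"
  shows "x \<in> V \<or> inv x \<in> V"
proof -
  obtain r where r: "v x = Some r" "length r = k"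
    using v_Some assms by blast
  have "inv x \<in> carrier K"
    using assms field_Units by blast
  then show ?thesis
    using V_iff[OF assms(1) r] V_iff[OF _ v_inv[OF assms r]] r lex_nonneg_uminus by auto
qed

lemma V_units:
  assumes "x \<in> V" "x \<noteq> \<zero>"
  shows "inv x \<in> V \<longleftrightarrow> v x = zvec_zero k"
proof -
  have x: "x \<in> carrier K" using assms by (simp add: V_def)
  obtain r where r: "v x = Some r" "length r = k"
    using v_Some[OF x assms(2)] by blast
  have "inv x \<in> carrier K"
    using x assms(2) field_Units by blast
  then have "inv x \<in> V \<longleftrightarrow> lex_nonneg (map uminus r)"
    using V_iff[OF _ v_inv[OF x assms(2) r]] r by simp
  moreover have "lex_nonneg r"
    using assms V_iff[OF x r] by simp
  moreover have "lex_nonneg (map uminus (replicate n 0))" for n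
    by (induction n) auto
  ultimately have "inv x \<in> V \<longleftrightarrow> r = replicate k 0"
    using lex_nonneg_antisym[of r] r(2) by metis
  then show ?thesis
    by (simp add: r(1) zvec_zero_def)
qed

lemma uniformized:
  assumes t: "t \<in> carrier K" "v t = zvec_unit k (k - 1)" and k: "k > 0"
  shows "uniformized_field K V t"
proof -
  obtain m where m: "k = Suc m"
    using k gr0_implies_Suc by blast
  have t0: "t \<noteq> \<zero>"
    using t(2) v_zero by (auto simp: zvec_unit_def)
  have vt: "v t = Some (replicate m 0 @ [1])"
    using t(2) by (simp add: m zvec_unit_last)
  have it: "inv t \<in> carrier K"
    using t(1) t0 field_Units by blast
  have vit: "v (inv t) = Some (replicate m 0 @ [- 1])"
    using v_inv[OF t(1) t0 vt] by (simp add: m)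
  have len: "length (replicate m (0::int) @ [1]) = k" "length (replicate m (0::int) @ [- 1]) = k"
    by (simp_all add: m)
  have mult: "x \<otimes> y \<in> V" if "x \<in> V" "y \<in> V" for x y
  proof (cases "x = \<zero> \<or> y = \<zero>")
    case True
    then show ?thesis
      using that by (auto simp: V_def v_zero)
  next
    case False
    have c: "x \<in> carrier K" "y \<in> carrier K" using that by (auto simp: V_def)
    obtain r s where r: "v x = Some r" "length r = k" and s: "v y = Some s" "length s = k"
      using v_Some c False by metis
    have "v (x \<otimes> y) = Some (map2 (+) r s)"
      using v_mult[OF c] r s by simp
    then show ?thesis
      using V_iff[of "x \<otimes> y" "map2 (+) r s"] V_iff[OF c(1) r] V_iff[OF c(2) s] that c
        lex_nonneg_add[of r s] r s by simp
  qed
  have one: "\<one> \<in> V"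
    by (simp add: V_def v_one zvec_zero_def)
  \<comment> \<open>The element \<open>-1\<close> is its own inverse, and of an element and its inverse one lies in \<open>V\<close>.\<close>
  have m1: "\<ominus> \<one> \<in> V"
  proof -
    have "inv (\<ominus> \<one>) = \<ominus> \<one>"
      by (rule comm_inv_char) (auto simp: l_minus r_minus)
    then show ?thesis
      using V_inv[of "\<ominus> \<one>"] by auto
  qed
  show ?thesis
  proof
    show "V \<subseteq> carrier K" by (auto simp: V_def)
    show "\<one> \<in> V" by (fact one)
    fix x y assume x: "x \<in> V"
    then have c: "x \<in> carrier K" by (simp add: V_def)
    show "\<ominus> x \<in> V"
      using mult[OF m1 x] c by (simp add: l_minus)
    { assume y: "y \<in> V"
      show "x \<otimes> y \<in> V" using x y by (rule mult)
      have "zvec_le (zvec_min (v x) (v y)) (v (x \<oplus> y))"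
        using valuation x y by (simp add: valuation_onto_def V_def)
      moreover have "zvec_le (zvec_zero k) (zvec_min (v x) (v y))"
        using x y by (simp add: zvec_min_def V_def)
      ultimately show "x \<oplus> y \<in> V"
        using zvec_le_trans_zero x y by (auto simp: V_def) }
    assume x0: "x \<noteq> \<zero>" and ix: "inv x \<notin> V"
    obtain r where r: "v x = Some r" "length r = k"
      using v_Some c x0 by blast
    have "lex_nonneg r" using V_iff[OF c r] x by simp
    moreover have "r \<noteq> replicate k 0"
      using V_units[OF x x0] ix r by (auto simp: zvec_zero_def)
    ultimately have "lex_nonneg (map2 (+) (replicate m 0 @ [- 1]) r)"
      using r by (intro lex_nonneg_diff_unit) (simp_all add: m)
    moreover have "v (inv t \<otimes> x) = Some (map2 (+) (replicate m 0 @ [- 1]) r)"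
      using v_mult[OF it c] vit r by simp
    ultimately show "inv t \<otimes> x \<in> V"
      using V_iff[of "inv t \<otimes> x"] it c r by (simp add: m)
  next
    fix x assume "x \<in> carrier K" "x \<noteq> \<zero>"
    then show "x \<in> V \<or> inv x \<in> V" by (rule V_inv)
  next
    have "lex_nonneg (replicate m 0 @ [1])"
      by (induction m) auto
    then show "t \<in> V" using V_iff[OF t(1) vt len(1)] by simp
    show "t \<noteq> \<zero>" by (fact t0)
    show "inv t \<notin> V"
      using V_iff[OF it vit len(2)] not_lex_nonneg_uminus_unit by simp
  qed
qed

end

section \<open>Angular components\<close>

lemma (in field) int_pow_units:
  assumes "a \<in> carrier R" "a \<noteq> \<zero>"
  shows "a [^]\<^bsub>units_of R\<^esub> (z::int) = a [^] z"
proof -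
  have u: "a \<in> Units R" using assms by (simp add: field_Units)
  have pow: "a [^]\<^bsub>units_of R\<^esub> (n::nat) = a [^] n" for n
    using u by (rule units_of_pow)
  have inv: "inv\<^bsub>units_of R\<^esub> (a [^] n) = inv (a [^] n)" for n :: nat
    using u by (intro units_of_inv Units_pow_closed)
  show ?thesis
    unfolding int_pow_def2 pow inv ..
qed

lemma (in field) int_pow_nonzero_closed:
  assumes "a \<in> carrier R" "a \<noteq> \<zero>"
  shows "a [^] (z::int) \<in> carrier R"
proof -
  interpret U: group "units_of R" by (rule units_group)
  have "a [^]\<^bsub>units_of R\<^esub> z \<in> Units R"
    using assms U.int_pow_closed[of a z] by (simp add: units_of_carrier field_Units)
  then show ?thesis
    using int_pow_units[OF assms] by auto
qed

lemma (in field) int_pow_pred: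
  assumes "a \<in> carrier R" "a \<noteq> \<zero>"
  shows "a \<otimes> a [^] (z - 1) = a [^] (z::int)"
proof -
  interpret U: group "units_of R" by (rule units_group)
  have "a [^]\<^bsub>units_of R\<^esub> (1 + (z - 1)) = a [^]\<^bsub>units_of R\<^esub> (1::int) \<otimes>\<^bsub>units_of R\<^esub> a [^]\<^bsub>units_of R\<^esub> (z - 1)"
    using assms by (intro U.int_pow_mult) (simp add: units_of_carrier field_Units)
  moreover have "a [^]\<^bsub>units_of R\<^esub> (1::int) = a"
    using assms by (intro U.int_pow_1) (simp add: units_of_carrier field_Units)
  ultimately show ?thesis
    using int_pow_units[OF assms] by (simp add: units_of_mult)
qed

text \<open>A field with a valuation onto \<open>\<int>\<^sup>k\<close> and elements \<open>\<tau>\<close> whose values are the unit vectors, which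
  define the natural angular component map. The last of them has the least positive value.\<close>

locale natural_ac_field = lex_valued_field K k v
  for K :: "'a ring" (structure) and k :: nat and v :: "'a \<Rightarrow> zvec" +
  fixes \<tau> :: "'a list"
  assumes k_pos: "k > 0" and length_\<tau>: "length \<tau> = k"
    and \<tau>: "i < k \<Longrightarrow> \<tau> ! i \<in> carrier K \<and> v (\<tau> ! i) = zvec_unit k i"
begin

abbreviation "t \<equiv> last \<tau>"

lemma t_eq: "t = \<tau> ! (k - 1)"
  using length_\<tau> k_pos by (auto simp: last_conv_nth)

sublocale uniformized_field K V t
  using \<tau>[of "k - 1"] k_pos by (intro uniformized) (auto simp: t_eq)

lemma M_eq: "M = valuation_ideal K k v"
proof -
  have "x \<in> M \<longleftrightarrow> x \<in> valuation_ideal K k v" for x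
  proof (cases "x = \<zero>")
    case True
    then show ?thesis
      using zero_in_M by (simp add: valuation_ideal_def v_zero zvec_zero_def)
  next
    case False
    then have "x \<in> M \<longleftrightarrow> x \<in> V \<and> v x \<noteq> zvec_zero k"
      using V_units[of x] by (auto simp: M_iff)
    moreover have "x \<in> V \<longleftrightarrow> x \<in> carrier K \<and> zvec_le (zvec_zero k) (v x)"
      by (simp add: V_def)
    ultimately show ?thesis
      by (simp add: valuation_ideal_def)
  qed
  then show ?thesis by blast
qed

lemma residue_class_eq: "residue_class K k v x = (\<lambda>h. h \<oplus> x) ` M"
  by (auto simp: residue_class_def a_r_coset_def' valuation_ring_def M_eq)

lemma residue_one: "\<one>\<^bsub>residue_field K k v\<^esub> = residue_class K k v \<one>"
  by (simp add: residue_field_def FactRing_def residue_class_def valuation_ring_def)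

lemma residue_class_eq_one_iff:
  assumes "x \<in> carrier K"
  shows "residue_class K k v x = \<one>\<^bsub>residue_field K k v\<^esub> \<longleftrightarrow> x \<ominus> \<one> \<in> M"
proof
  assume "residue_class K k v x = \<one>\<^bsub>residue_field K k v\<^esub>"
  then have "x \<in> (\<lambda>h. h \<oplus> \<one>) ` M"
    using zero_in_M assms unfolding residue_one residue_class_eq by force
  then obtain h where "h \<in> M" "x = h \<oplus> \<one>" by blast
  then show "x \<ominus> \<one> \<in> M"
    using M_carrier by (simp add: minus_eq a_assoc r_neg)
next
  assume *: "x \<ominus> \<one> \<in> M"
  have 1: "h \<oplus> x = (h \<oplus> (x \<ominus> \<one>)) \<oplus> \<one>" "h \<oplus> \<one> = (h \<oplus> \<ominus> (x \<ominus> \<one>)) \<oplus> x" if "h \<in> M" for h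
  proof -
    have "x \<oplus> (\<one> \<oplus> \<ominus> x) = \<one>" "x \<oplus> (\<one> \<oplus> \<ominus> \<one>) = x"
      using assms by (simp_all add: a_lcomm[of x \<one>] r_neg)
    then show "h \<oplus> x = (h \<oplus> (x \<ominus> \<one>)) \<oplus> \<one>" "h \<oplus> \<one> = (h \<oplus> \<ominus> (x \<ominus> \<one>)) \<oplus> x"
      using assms M_carrier[OF that] by (simp_all add: minus_eq minus_add a_ac)
  qed
  have 2: "h \<oplus> (x \<ominus> \<one>) \<in> M" "h \<oplus> \<ominus> (x \<ominus> \<one>) \<in> M" if "h \<in> M" for h
    using * that by (auto intro: M_add M_uminus)
  show "residue_class K k v x = \<one>\<^bsub>residue_field K k v\<^esub>"
    unfolding residue_one residue_class_eq
  proof (intro equalityI image_subsetI)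
    fix h assume h: "h \<in> M"
    show "h \<oplus> x \<in> (\<lambda>h. h \<oplus> \<one>) ` M"
      unfolding 1(1)[OF h] using 2(1)[OF h] by (rule imageI)
    show "h \<oplus> \<one> \<in> (\<lambda>h. h \<oplus> x) ` M"
      unfolding 1(2)[OF h] using 2(2)[OF h] by (rule imageI)
  qed
qed

lemma \<tau>_nonzero: "i < k \<Longrightarrow> \<tau> ! i \<noteq> \<zero>"
  using \<tau>[of i] v_zero by (auto simp: zvec_unit_def)

lemma natural_ac_mult_t:
  assumes "x \<in> carrier K" "x \<noteq> \<zero>"
  shows "natural_ac K k v \<tau> (t \<otimes> x) = natural_ac K k v \<tau> x"
proof -
  obtain r where r: "v x = Some r" "length r = k"
    using v_Some assms by blast
  obtain m where m: "k = Suc m"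
    using k_pos gr0_implies_Suc by blast
  define s where "s = map2 (+) (replicate m 0 @ [1]) r"
  have vtx: "v (t \<otimes> x) = Some s"
    using v_mult[of t x] \<tau>[of m] r assms by (simp add: t_eq m zvec_unit_last s_def)
  have s_less: "s ! i = r ! i" if "i < m" for i
    using that r by (simp add: s_def m nth_append)
  have s_last: "s ! m = r ! m + 1"
    using r by (simp add: s_def m nth_append)
  have s_last': "- (s ! m) = - (r ! m) - 1"
    by (simp add: s_last)
  define f where "f r i = (\<tau> ! i) [^] (- (r ! i))" for r :: "int list" and i
  have f: "f r i \<in> carrier K" if "i < k" for r i
    using that \<tau> \<tau>_nonzero by (simp add: f_def int_pow_nonzero_closed)
  have k: "{..<k} = insert m {..<m}"
    by (auto simp: m)
  have prod: "(\<Otimes>i\<in>{..<k}. f r i) = f r m \<otimes> (\<Otimes>i\<in>{..<m}. f r i)" for r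
    unfolding k using f by (intro finprod_insert) (auto simp: m)
  have "(\<Otimes>i\<in>{..<m}. f s i) = (\<Otimes>i\<in>{..<m}. f r i)"
    using f s_less by (intro finprod_cong') (auto simp: m f_def)
  moreover have "t \<otimes> f s m = f r m"
    using int_pow_pred[of "\<tau> ! m" "- (r ! m)"] \<tau>[of m] \<tau>_nonzero[of m]
    by (simp add: f_def s_last' t_eq m)
  moreover have "(\<Otimes>i\<in>{..<m}. f r i) \<in> carrier K" "f s m \<in> carrier K"
    using f by (auto simp: m intro!: finprod_closed)
  ultimately have "t \<otimes> x \<otimes> (\<Otimes>i\<in>{..<k}. f s i) = x \<otimes> (\<Otimes>i\<in>{..<k}. f r i)"
    unfolding prod using assms(1) t_carrier by (metis m_assoc m_comm m_closed)
  moreover have "t \<otimes> x \<noteq> \<zero>"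
    using assms t_nonzero by (simp add: integral_iff)
  ultimately show ?thesis
    using assms(2) by (simp add: natural_ac_def vtx r(1) f_def)
qed

lemma natural_ac_unit:
  assumes "x \<in> carrier K" "v x = zvec_zero k"
  shows "natural_ac K k v \<tau> x = residue_class K k v x"
proof -
  have "x \<noteq> \<zero>"
    using assms v_zero by (auto simp: zvec_zero_def)
  moreover have "(\<Otimes>i\<in>{..<k}. (\<tau> ! i) [^] (- (the (v x) ! i))) = \<one>"
    by (rule finprod_one_eqI) (simp add: assms(2) zvec_zero_def)
  ultimately show ?thesis
    using assms(1) by (simp add: natural_ac_def)
qed

text \<open>The elements with angular component \<open>1\<close>.\<close>

definition U :: "'a set" where
  "U = {x \<in> carrier K. natural_ac K k v \<tau> x = \<one>\<^bsub>residue_field K k v\<^esub>}"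

sublocale uniformized_field_ac K V t U
proof
  show "U \<subseteq> carrier K" by (auto simp: U_def)
  show "t \<otimes> x \<in> U \<longleftrightarrow> x \<in> U" if "x \<in> carrier K" "x \<noteq> \<zero>" for x
    using that natural_ac_mult_t by (simp add: U_def)
  show "x \<in> U \<longleftrightarrow> x \<ominus> \<one> \<in> M" if "x \<in> V" "x \<noteq> \<zero>" "inv x \<in> V" for x
    using that V_units[of x] V_carrier[of x] natural_ac_unit[of x] residue_class_eq_one_iff[of x]
    by (simp add: U_def)
qed

end

section \<open>Definability of the bijection\<close>

abbreviation (input) Disj ::
    "('rf, 'rr, 'gf, 'gr) pas_formula \<Rightarrow> ('rf, 'rr, 'gf, 'gr) pas_formula \<Rightarrow> ('rf, 'rr, 'gf, 'gr) pas_formula" where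
  "Disj \<phi> \<psi> \<equiv> Neg (Conj (Neg \<phi>) (Neg \<psi>))"

text \<open>The term for a power with constant exponent.\<close>

primrec fterm_pow :: "fterm \<Rightarrow> nat \<Rightarrow> fterm" where
  "fterm_pow s 0 = FOne"
| "fterm_pow s (Suc n) = FMult (fterm_pow s n) s"

lemma feval_fterm_pow: "feval K \<rho> (fterm_pow s n) = feval K \<rho> s [^]\<^bsub>K\<^esub> n"
  by (induction n) (simp_all add: nat_pow_def)

text \<open>Formulas for membership in the valuation ring \<open>V\<close>, in its maximal ideal \<open>M\<close>, and in the set \<open>U\<close>
  of elements with angular component \<open>1\<close>.\<close>

definition in_V :: "fterm \<Rightarrow> ('rf, 'rr, 'gf, 'gr) pas_formula" where
  "in_V s = GLe GZero (GVal s)"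

definition in_M :: "fterm \<Rightarrow> ('rf, 'rr, 'gf, 'gr) pas_formula" where
  "in_M s = Conj (in_V s) (Neg (GEq (GVal s) GZero))"

definition in_U :: "fterm \<Rightarrow> ('rf, 'rr, 'gf, 'gr) pas_formula" where
  "in_U s = REq (RAc s) ROne"

text \<open>The term \<open>x\<^sup>p + t y\<^sup>p\<close>.\<close>

definition embed_term :: "nat \<Rightarrow> fterm \<Rightarrow> fterm \<Rightarrow> fterm \<Rightarrow> fterm" where
  "embed_term p t x y = FAdd (fterm_pow x p) (FMult t (fterm_pow y p))"

text \<open>The disjuncts are those of the relation \<open>shift_rel\<close>, in the same order.\<close>

definition shift_formula :: "fterm \<Rightarrow> fterm \<Rightarrow> fterm \<Rightarrow> fterm \<Rightarrow> fterm \<Rightarrow> ('rf, 'rr, 'gf, 'gr) pas_formula" where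
  "shift_formula t x y x' y' =
     Disj (Conj (in_U x) (Conj (Neg (in_V x)) (Conj (in_M y) (Conj (Neg (FEq y FZero))
       (Conj (FEq x' (FMult t x)) (FEq y' y))))))
    (Disj (Conj (in_U x) (Conj (in_V x) (Conj (Neg (in_M x)) (Conj (Neg (FEq x FOne)) (Conj (in_M y)
       (Conj (Neg (FEq y FZero)) (Conj (FEq x' y)
         (FEq (FMult t y') (FMult y (FAdd x (FUminus FOne)))))))))))
    (Disj (Conj (FEq x FOne) (Conj (in_M y) (Conj (Neg (FEq y FZero))
       (Conj (FEq x' (FAdd FOne y)) (FEq y' FZero)))))
    (Disj (Conj (FEq x FZero) (Conj (FEq y FZero) (Conj (FEq x' FOne) (FEq y' FZero))))
    (Disj (Conj (in_M x) (Conj (Neg (FEq x FZero)) (Conj (in_M y) (Conj (Neg (FEq y FZero))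
       (Conj (FEq x' (FMult x y)) (FEq y' y))))))
    (Conj (in_U x) (Conj (Neg (in_M x)) (Conj (FEq y FZero) (Conj (FEq (FMult t x') x) (FEq y' FZero)))))))))"

text \<open>The formula for the graph of \<open>puncture\<close>. The variables \<open>0\<close> and \<open>1\<close> are the coordinates, the
  variables \<open>2\<close> to \<open>5\<close> are bound, and the variable \<open>6\<close> stands for the parameter \<open>t\<close>.\<close>

definition puncture_formula :: "nat \<Rightarrow> ('rf, 'rr, 'gf, 'gr) pas_formula" where
  "puncture_formula p =
    (let z = FVar 0; w = FVar 1; x = FVar 2; y = FVar 3; x' = FVar 4; y' = FVar 5; t = FVar 6 in
      Disj (FEx 2 (FEx 3 (FEx 4 (FEx 5 (Conj (FEq z (embed_term p t x y))
          (Conj (shift_formula t x y x' y') (FEq w (embed_term p t x' y'))))))))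
        (Conj (Neg (FEx 2 (FEx 3 (FEx 4 (FEx 5 (Conj (FEq z (embed_term p t x y))
          (shift_formula t x y x' y')))))))
          (FEq w z)))"

lemma pas_formula_wf_puncture: "pas_formula_wf S (puncture_formula p)"
  by (simp add: puncture_formula_def Let_def shift_formula_def in_V_def in_M_def in_U_def)

context natural_ac_field
begin

lemma pas_sat_membership:
  assumes S: "S = denef_pas_structure K k v \<tau> E\<^sub>k E\<^sub>G"
    and "feval K \<rho> s \<in> carrier K"
  shows "pas_sat S \<rho> \<sigma> \<gamma> (in_V s) \<longleftrightarrow> feval K \<rho> s \<in> V"
    "pas_sat S \<rho> \<sigma> \<gamma> (in_M s) \<longleftrightarrow> feval K \<rho> s \<in> M"
    "pas_sat S \<rho> \<sigma> \<gamma> (in_U s) \<longleftrightarrow> feval K \<rho> s \<in> U"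
proof -
  show V: "pas_sat S \<rho> \<sigma> \<gamma> (in_V s) \<longleftrightarrow> feval K \<rho> s \<in> V"
    using assms(2) by (simp add: S denef_pas_structure_def in_V_def V_def)
  show "pas_sat S \<rho> \<sigma> \<gamma> (in_M s) \<longleftrightarrow> feval K \<rho> s \<in> M"
    unfolding M_eq using assms(2)
    by (simp add: S denef_pas_structure_def in_V_def in_M_def valuation_ideal_def)
  show "pas_sat S \<rho> \<sigma> \<gamma> (in_U s) \<longleftrightarrow> feval K \<rho> s \<in> U"
    using assms(2) by (simp add: S denef_pas_structure_def in_U_def U_def)
qed

lemma pas_sat_shift:
  assumes S: "S = denef_pas_structure K k v \<tau> E\<^sub>k E\<^sub>G"
    and "feval K \<rho> s = t" "feval K \<rho> x \<in> carrier K" "feval K \<rho> y \<in> carrier K"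
  shows "pas_sat S \<rho> \<sigma> \<gamma> (shift_formula s x y x' y') \<longleftrightarrow>
    shift_rel (feval K \<rho> x) (feval K \<rho> y) (feval K \<rho> x') (feval K \<rho> y')"
proof -
  have "valued_field S = K" by (simp add: S denef_pas_structure_def)
  then show ?thesis
    using assms(2-4)
    by (simp add: shift_formula_def shift_rel_def pas_sat_membership[OF S]) (simp only: conj_ac)
qed

end

theorem (in natural_ac_field) definable_bij_puncture:
  fixes S :: "('a, 'rf, 'rr, 'gf, 'gr) pas_structure" and p :: nat
  assumes S: "S = denef_pas_structure K k v \<tau> E\<^sub>k E\<^sub>G"
    and p: "prime p" "[p] \<cdot> \<one> = \<zero>"
  shows "inhabited_pas S"
    "\<exists>f. definable_bij S f 1 (cart_power (carrier K) 1) 1 (cart_power (carrier K - {\<zero>}) 1)"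
proof -
  interpret uniformized_field_char K V t U p
    using p by unfold_locales
  have vf: "valued_field S = K"
    by (simp add: S denef_pas_structure_def)
  have res: "carrier (residue_sort S) \<noteq> {}"
    using V_one by (auto simp: S denef_pas_structure_def residue_field_def FactRing_def A_RCOSETS_def'
        valuation_ring_def V_def)
  show inh: "inhabited_pas S"
    by (rule inhabited_pas.intro) (simp_all add: vf res is_ring)
  interpret P: inhabited_pas S by (rule inh)
  let ?f = "\<lambda>xs. [puncture (hd xs)]"
  have line: "cart_power A 1 = (\<lambda>x. [x]) ` A" for A :: "'a set"
    by (auto simp: cart_power_def length_Suc_conv)
  have sat: "pas_sat S (\<lambda>i. if i < 2 then [z, w] ! i else t) \<sigma> \<gamma> (puncture_formula p) \<longleftrightarrow> w = puncture z"
    if "z \<in> carrier K" "w \<in> carrier K" for z w \<sigma> \<gamma>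
    unfolding graph_puncture[OF that]
    by (simp add: puncture_formula_def Let_def vf pas_sat_shift[OF S] embed_term_def feval_fterm_pow
        embed_def)
  have "definable S 2 {xs \<in> cart_power (carrier K) 2.
      pas_sat S (\<lambda>i. if i < 2 then xs ! i else t) (\<lambda>_. SOME a. a \<in> carrier (residue_sort S)) (\<lambda>_. None)
        (puncture_formula p)}"
    using definable_Collect[OF pas_formula_wf_puncture _ res, of t 2 p] by (simp add: vf)
  also have "{xs \<in> cart_power (carrier K) 2.
      pas_sat S (\<lambda>i. if i < 2 then xs ! i else t) (\<lambda>_. SOME a. a \<in> carrier (residue_sort S)) (\<lambda>_. None)
        (puncture_formula p)} = {xs @ ?f xs | xs. xs \<in> cart_power (carrier K) 1}"
    (is "?L = ?R")
  proof (intro equalityI subsetI)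
    fix xs assume xs: "xs \<in> ?L"
    then obtain z w where zw: "xs = [z, w]" "z \<in> carrier K" "w \<in> carrier K"
      by (auto simp: cart_power_def length_Suc_conv numeral_2_eq_2)
    then have "w = puncture z"
      using xs sat by simp
    with zw show "xs \<in> ?R"
      unfolding line by force
  next
    fix xs assume "xs \<in> ?R"
    then obtain z where z: "xs = [z, puncture z]" "z \<in> carrier K"
      unfolding line by auto
    moreover have "puncture z \<in> carrier K"
      using bij_betw_apply[OF bij_puncture z(2)] by simp
    ultimately show "xs \<in> ?L"
      using sat by (simp add: cart_power_def)
  qed
  finally have graph: "definable S (1 + 1) {xs @ ?f xs | xs. xs \<in> cart_power (carrier K) 1}"
    unfolding one_add_one .
  have "definable S 1 {xs \<in> cart_power (carrier K) 1. xs ! 0 = \<zero>}"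
    using P.definable_coordinate_zero[of 0 1] by (simp add: vf)
  then have "definable S 1 (cart_power (carrier K) 1 - {xs \<in> cart_power (carrier K) 1. xs ! 0 = \<zero>})"
    using definable_Diff[of S 1] by (simp only: vf)
  moreover have "cart_power (carrier K) 1 - {xs \<in> cart_power (carrier K) 1. xs ! 0 = \<zero>} =
      cart_power (carrier K - {\<zero>}) 1"
    by (rule Set.set_eqI) (force simp: cart_power_def length_Suc_conv)
  moreover have "bij_betw ?f (cart_power (carrier K) 1) (cart_power (carrier K - {\<zero>}) 1)"
    unfolding line
  proof (rule bij_betw_imageI)
    show "inj_on ?f ((\<lambda>x. [x]) ` carrier K)"
      using bij_betw_imp_inj_on[OF bij_puncture] by (auto simp: inj_on_def)
    have "?f ` (\<lambda>x. [x]) ` carrier K = (\<lambda>x. [x]) ` puncture ` carrier K"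
      by (simp add: image_image)
    then show "?f ` (\<lambda>x. [x]) ` carrier K = (\<lambda>x. [x]) ` (carrier K - {\<zero>})"
      unfolding bij_betw_imp_surj_on[OF bij_puncture] .
  qed
  moreover have "definable S 1 (cart_power (carrier K) 1)"
    using P.definable_UNIV[of 1] by (simp add: vf)
  ultimately show "\<exists>f. definable_bij S f 1 (cart_power (carrier K) 1) 1 (cart_power (carrier K - {\<zero>}) 1)"
    using graph unfolding definable_bij_def by (intro exI[of _ ?f]) simp
qed

section \<open>Iterated Laurent series fields of positive characteristic\<close>

theorem theorem4:
  fixes L :: "('a, 'm) ring_scheme"
    and p n k :: nat
    and K :: "'a laurent ring"
    and v :: "'a laurent \<Rightarrow> zvec"
    and \<tau> :: "'a laurent list"
    and E\<^sub>k :: "('rf, 'rr, 'a laurent set) expansion"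
    and E\<^sub>G :: "('gf, 'gr, zvec) expansion"
    and S :: "('a laurent, 'rf, 'rr, 'gf, 'gr) pas_structure"
  assumes "field L" and "has_characteristic L p" and "p > 0"
    and "n \<ge> 1" and "K = iterated_laurent L n"
    and "k > 0" and "valuation_onto K k v"
    and "length \<tau> = k"
    and "\<forall>i<k. \<tau> ! i \<in> carrier K \<and> v (\<tau> ! i) = zvec_unit k i"
    and "expansion_on (carrier (residue_field K k v)) E\<^sub>k"
    and "expansion_on (zgroup_inf k) E\<^sub>G"
    and "S = denef_pas_structure K k v \<tau> E\<^sub>k E\<^sub>G"
  shows "carrier (grothendieck_ring S) = {\<zero>\<^bsub>grothendieck_ring S\<^esub>} \<and>
    (\<exists>f. definable_bij S f
           1 (cart_power (carrier K) 1)
           1 (cart_power (carrier K - {\<zero>\<^bsub>K\<^esub>}) 1))"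
proof -
  have K: "field K" "has_characteristic K p"
    using iterated_laurent_field[OF assms(1,2)] assms(5) by simp_all
  interpret field K by (rule K(1))
  interpret natural_ac_field K k v \<tau>
    using assms by unfold_locales auto
  have p: "prime p" "[p] \<cdot>\<^bsub>K\<^esub> \<one>\<^bsub>K\<^esub> = \<zero>\<^bsub>K\<^esub>"
    using prime_characteristic[OF K(2) assms(3)] K(2) by (auto simp: has_characteristic_def)
  have vf: "valued_field S = K"
    by (simp add: assms(12) denef_pas_structure_def)
  obtain f where f: "definable_bij S f 1 (cart_power (carrier K) 1) 1 (cart_power (carrier K - {\<zero>\<^bsub>K\<^esub>}) 1)"
    using definable_bij_puncture(2)[OF assms(12) p] by blast
  moreover have "carrier (grothendieck_ring S) = {\<zero>\<^bsub>grothendieck_ring S\<^esub>}"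
    using inhabited_pas.grothendieck_ring_trivial[OF definable_bij_puncture(1)[OF assms(12) p]] f
    by (simp only: vf)
  ultimately show ?thesis by blast
qed

end
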